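(* Let $\mathcal{C}:\mathcal{Q}Sym\to\mathcal{Y}Sym$, $\Gamma:\mathcal{Y}Sym\to\mathfrak{S}Sym$ and $\mathcal{Z}:\mathcal{Q}Sym\to\mathfrak{S}Sym$ be the linear maps $\mathcal{C}(M_{\mathsf{S}})=M_{C(\mathsf{S})}$, $\Gamma(M_t)=M_{\gamma(t)}$, $\mathcal{Z}(M_{\mathsf{S}})=M_{Z(\mathsf{S})}$. Then $\mathcal{C},\Gamma,\mathcal{Z}$ are injective morphisms of coalgebras, $\Gamma\circ\mathcal{C}=\mathcal{Z}$, and they split the surjections $\mathcal{L},\Lambda,\mathcal{D}$: $\mathcal{L}\circ\mathcal{C}=\mathrm{id}_{\mathcal{Q}Sym}$, $\Lambda\circ\Gamma=\mathrm{id}_{\mathcal{Y}Sym}$, $\mathcal{D}\circ\mathcal{Z}=\mathrm{id}_{\mathcal{Q}Sym}$.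
   Context: Permutations in one-line notation; $\mathrm{st}$ standardizes a sequence of distinct integers to a permutation with the same relative order. Weak order on $\mathfrak{S}_n$: inclusion of inversion sets. For $\sigma\in\mathfrak{S}_p,\tau\in\mathfrak{S}_q$: $\sigma\vee\tau=(\sigma(1)+q,..,\sigma(p)+q,p+q+1,\tau(1),..,\tau(q))$, $\sigma\backslash\tau=(\sigma(1)+q,..,\sigma(p)+q,\tau(1),..,\tau(q))$. $\mathrm{Des}(\sigma)=\{i:\sigma(i)>\sigma(i+1)\}$. For $\mathsf{S}=\{p_1<\dots<p_k\}\subseteq[n-1]$, $Z(\mathsf{S})=\mathrm{id}_{p_1}\backslash\mathrm{id}_{p_2-p_1}\backslash\cdots\backslash\mathrm{id}_{n-p_k}$. Trees: $\mathcal{Y}_n$ = rooted planar binary trees with $n$ internal nodes, $\mathcal{Y}_0=\{|\}$; $s\vee t$ = root with left subtree $s$, right subtree $t$. Tamari order generated by replacing a subtree $(a\vee b)\vee c$ by the larger $a\vee(b\vee c)$. $s\backslash t$: $|\backslash t=t$, $s\backslash t=s_l\vee(s_r\backslash t)$. $1_0=|$, $1_n=1_{n-1}\vee|$, $C(\mathsf{S})=1_{p_1}\backslash\cdots\backslash1_{n-p_k}$. $L(t)$: with leaves numbered $0..n$, the set of $i\in[n-1]$ with leaf $i$ a left child. $\lambda(\mathrm{id}_0)=|$, $\lambda(\sigma)=\lambda(\mathrm{st}(\sigma(1..j-1)))\vee\lambda(\mathrm{st}(\sigma(j+1..n)))$, $j=\sigma^{-1}(n)$; $\gamma(|)=\mathrm{id}_0$,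 $\gamma(t)=\gamma(t_l)\vee\gamma(t_r)$. Hopf algebras over $\mathbb{Q}$: $\mathfrak{S}Sym$ has basis $F_\sigma$ with coproduct $\Delta(F_\sigma)=\sum_{p=0}^nF_{\mathrm{st}(\sigma(1),..,\sigma(p))}\otimes F_{\mathrm{st}(\sigma(p+1),..,\sigma(n))}$ and $M_\sigma=\sum_{\sigma\le\tau}\mu_{\mathfrak{S}_n}(\sigma,\tau)F_\tau$. $\mathcal{Y}Sym$ has basis $F_t$ with coproduct $\Delta(F_t)=\sum_iF_{t_0}\otimes F_{t_1}$ over splittings $t\to(t_0,t_1)$ at leaves $i=0..n$, defined recursively by $|\to(|,|)$ and, for $t=t_l\vee t_r$, $t\to(a,b\vee t_r)$ if the leaf is in $t_l$ and $t_l\to(a,b)$, $t\to(t_l\vee c,d)$ if the leaf is in $t_r$ and $t_r\to(c,d)$; and $M_t=\sum_{t\le s}\mu_{\mathcal{Y}_n}(t,s)F_s$. $\mathcal{Q}Sym$ has in degree $n$ bases $M_{\mathsf{S}},F_{\mathsf{S}}$, $\mathsf{S}\subseteq[n-1]$, with $F_{\mathsf{S}}=\sum_{\mathsf{T}\supseteq\mathsf{S}}M_{\mathsf{T}}$; identifying $\mathsf{S}=\{p_1<\dots<p_k\}$ with the composition $(a_1,\dots,a_{k+1})=(p_1,p_2-p_1,\dots,n-p_k)$, the coproduct is $\Delta(M_{(a_1,\dots,a_m)})=\sum_{i=0}^mM_{(a_1,\dots,a_i)}\otimes M_{(a_{i+1},\dots,a_m)}$. The Hopf morphisms $\Lambda:\mathfrak{S}Sym\to\mathcal{Y}Sym$,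 $\mathcal{L}:\mathcal{Y}Sym\to\mathcal{Q}Sym$, $\mathcal{D}:\mathfrak{S}Sym\to\mathcal{Q}Sym$ are $F_\sigma\mapsto F_{\lambda(\sigma)}$, $F_t\mapsto F_{L(t)}$, $F_\sigma\mapsto F_{\mathrm{Des}(\sigma)}$. *)

theory Defs
  imports Complex_Main
begin

definition mobius :: "'a set \<Rightarrow> ('a \<Rightarrow> 'a \<Rightarrow> bool) \<Rightarrow> 'a \<Rightarrow> 'a \<Rightarrow> int" where
  "mobius P le = (THE f. \<forall>x y. f x y =
     (if x \<in> P \<and> y \<in> P \<and> le x y
      then (if x = y then 1 else - (\<Sum>z\<in>{z\<in>P. le x z \<and> le z y \<and> z \<noteq> y}. f x z))
      else 0))"

text \<open>Vectors over Q are coefficient functions with respect to a chosen basis.\<close>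
definition supp :: "('b \<Rightarrow> rat) \<Rightarrow> 'b set" where
  "supp v = {b. v b \<noteq> 0}"

definition lsum :: "('b \<Rightarrow> rat) \<Rightarrow> ('b \<Rightarrow> ('c \<Rightarrow> rat)) \<Rightarrow> ('c \<Rightarrow> rat)" where
  "lsum c g = (\<lambda>x. \<Sum>b\<in>supp c. c b * g b x)"

definition delta :: "'b \<Rightarrow> ('b \<Rightarrow> rat)" where
  "delta a = (\<lambda>x. if x = a then 1 else 0)"

definition coords :: "('b \<Rightarrow> ('c \<Rightarrow> rat)) \<Rightarrow> ('c \<Rightarrow> rat) \<Rightarrow> ('b \<Rightarrow> rat)" where
  "coords B v = (THE c. finite (supp c) \<and> v = lsum c B)"

definition tens :: "(('b \<Rightarrow> rat) \<Rightarrow> ('c \<Rightarrow> rat)) \<Rightarrow> ('b \<times> 'b \<Rightarrow> rat) \<Rightarrow> ('c \<times> 'c \<Rightarrow> rat)" where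
  "tens f w = lsum w (\<lambda>(a, b). \<lambda>(x, y). f (delta a) x * f (delta b) y)"

definition coalg_hom :: "('b \<Rightarrow> rat) set \<Rightarrow> (('b \<Rightarrow> rat) \<Rightarrow> ('b \<times> 'b \<Rightarrow> rat)) \<Rightarrow> (('b \<Rightarrow> rat) \<Rightarrow> rat)
   \<Rightarrow> (('c \<Rightarrow> rat) \<Rightarrow> ('c \<times> 'c \<Rightarrow> rat)) \<Rightarrow> (('c \<Rightarrow> rat) \<Rightarrow> rat)
   \<Rightarrow> (('b \<Rightarrow> rat) \<Rightarrow> ('c \<Rightarrow> rat)) \<Rightarrow> bool" where
  "coalg_hom V cop1 eps1 cop2 eps2 f \<longleftrightarrow>
     (\<forall>v\<in>V. cop2 (f v) = tens f (cop1 v) \<and> eps2 (f v) = eps1 v)"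

definition is_perm :: "nat \<Rightarrow> nat list \<Rightarrow> bool" where
  "is_perm n \<sigma> \<longleftrightarrow> length \<sigma> = n \<and> set \<sigma> = {1..n}"

definition perms :: "nat \<Rightarrow> nat list set" where
  "perms n = {\<sigma>. is_perm n \<sigma>}"

definition allperms :: "nat list set" where
  "allperms = {\<sigma>. is_perm (length \<sigma>) \<sigma>}"

definition idp :: "nat \<Rightarrow> nat list" where
  "idp n = [1..<Suc n]"

definition st :: "nat list \<Rightarrow> nat list" where
  "st xs = map (\<lambda>x. card {y \<in> set xs. y \<le> x}) xs"

lemma length_st[simp]: "length (st xs) = length xs"
  by (simp add: st_def)

definition invs :: "nat list \<Rightarrow> (nat \<times> nat) set" where
  "invs \<sigma> = {(i, j). i < j \<and> j < length \<sigma> \<and> \<sigma> ! i > \<sigma> ! j}"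

definition wle :: "nat list \<Rightarrow> nat list \<Rightarrow> bool" where
  "wle \<sigma> \<tau> \<longleftrightarrow> invs \<sigma> \<subseteq> invs \<tau>"

definition pvee :: "nat list \<Rightarrow> nat list \<Rightarrow> nat list" where
  "pvee \<sigma> \<tau> = map (\<lambda>x. x + length \<tau>) \<sigma> @ [length \<sigma> + length \<tau> + 1] @ \<tau>"

definition pbs :: "nat list \<Rightarrow> nat list \<Rightarrow> nat list" where
  "pbs \<sigma> \<tau> = map (\<lambda>x. x + length \<tau>) \<sigma> @ \<tau>"

text \<open>descent set, 1-indexed: i with sigma(i) > sigma(i+1)\<close>
definition Des :: "nat list \<Rightarrow> nat set" where
  "Des \<sigma> = {i. 1 \<le> i \<and> i < length \<sigma> \<and> \<sigma> ! (i - 1) > \<sigma> ! i}"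

text \<open>composition (p1, p2-p1, ..., n-pk) of a subset S of [n-1]; the empty composition for n = 0\<close>
definition comp_of :: "nat \<Rightarrow> nat set \<Rightarrow> nat list" where
  "comp_of n S = (if n = 0 then [] else
     (let ps = sorted_list_of_set S in map (\<lambda>(a, b). a - b) (zip (ps @ [n]) (0 # ps))))"

definition set_of_comp :: "nat list \<Rightarrow> nat \<times> nat set" where
  "set_of_comp as = (sum_list as, {sum_list (take i as) | i. 1 \<le> i \<and> i < length as})"

definition Zp :: "nat \<Rightarrow> nat set \<Rightarrow> nat list" where
  "Zp n S = foldr (\<lambda>a acc. pbs (idp a) acc) (comp_of n S) []"

datatype tree = Leaf | Node tree tree

fun nodes :: "tree \<Rightarrow> nat" where
  "nodes Leaf = 0"
| "nodes (Node l r) = Suc (nodes l + nodes r)"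

definition trees :: "nat \<Rightarrow> tree set" where
  "trees n = {t. nodes t = n}"

fun tbs :: "tree \<Rightarrow> tree \<Rightarrow> tree" where
  "tbs Leaf t = t"
| "tbs (Node l r) t = Node l (tbs r t)"

fun one_t :: "nat \<Rightarrow> tree" where
  "one_t 0 = Leaf"
| "one_t (Suc n) = Node (one_t n) Leaf"

definition Ct :: "nat \<Rightarrow> nat set \<Rightarrow> tree" where
  "Ct n S = foldr (\<lambda>a acc. tbs (one_t a) acc) (comp_of n S) Leaf"

inductive rot :: "tree \<Rightarrow> tree \<Rightarrow> bool" where
  "rot (Node (Node a b) c) (Node a (Node b c))"
| "rot s s' \<Longrightarrow> rot (Node s t) (Node s' t)"
| "rot t t' \<Longrightarrow> rot (Node s t) (Node s t')"

definition tamari :: "tree \<Rightarrow> tree \<Rightarrow> bool" where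
  "tamari = rot\<^sup>*\<^sup>*"

text \<open>for each leaf (left to right, leaves 0..n) whether it is a left child\<close>
fun ldirs :: "bool \<Rightarrow> tree \<Rightarrow> bool list" where
  "ldirs d Leaf = [d]"
| "ldirs d (Node l r) = ldirs True l @ ldirs False r"

definition Lset :: "tree \<Rightarrow> nat set" where
  "Lset t = {i. 1 \<le> i \<and> i < nodes t \<and> ldirs False t ! i}"

text \<open>lambda: split at the position j of the maximal value n\<close>
function lam :: "nat list \<Rightarrow> tree" where
  "lam [] = Leaf"
| "lam (x # xs) =
    (let \<sigma> = x # xs; n = length \<sigma>;
         j = min (length (takeWhile (\<lambda>y. y \<noteq> n) \<sigma>)) (length \<sigma> - 1)
     in Node (lam (st (take j \<sigma>))) (lam (st (drop (Suc j) \<sigma>))))"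
  by pat_completeness auto
termination
  by (relation "measure length") (auto simp: Let_def min_def)

fun gam :: "tree \<Rightarrow> nat list" where
  "gam Leaf = []"
| "gam (Node l r) = pvee (gam l) (gam r)"

text \<open>splittings t -> (t0, t1), one for each leaf 0..n\<close>
fun splits :: "tree \<Rightarrow> (tree \<times> tree) list" where
  "splits Leaf = [(Leaf, Leaf)]"
| "splits (Node l r) = map (\<lambda>(a, b). (a, Node b r)) (splits l) @ map (\<lambda>(c, d). (Node l c, d)) (splits r)"

text \<open>SSym: vectors in coordinates w.r.t. the basis F_sigma (sigma in allperms).\<close>
definition SVec :: "(nat list \<Rightarrow> rat) set" where
  "SVec = {v. finite (supp v) \<and> supp v \<subseteq> allperms}"

definition SM :: "nat list \<Rightarrow> (nat list \<Rightarrow> rat)" where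
  "SM \<sigma> = (\<lambda>\<tau>. of_int (mobius (perms (length \<sigma>)) wle \<sigma> \<tau>))"

definition SCop :: "(nat list \<Rightarrow> rat) \<Rightarrow> (nat list \<times> nat list \<Rightarrow> rat)" where
  "SCop v = lsum v (\<lambda>\<sigma> (x, y). \<Sum>p\<in>{0..length \<sigma>}.
      if (st (take p \<sigma>), st (drop p \<sigma>)) = (x, y) then 1 else 0)"

definition SEps :: "(nat list \<Rightarrow> rat) \<Rightarrow> rat" where
  "SEps v = v []"

text \<open>YSym: vectors in coordinates w.r.t. the basis F_t.\<close>
definition YVec :: "(tree \<Rightarrow> rat) set" where
  "YVec = {v. finite (supp v)}"

definition YM :: "tree \<Rightarrow> (tree \<Rightarrow> rat)" where
  "YM t = (\<lambda>s. of_int (mobius (trees (nodes t)) tamari t s))"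

definition YCop :: "(tree \<Rightarrow> rat) \<Rightarrow> (tree \<times> tree \<Rightarrow> rat)" where
  "YCop v = lsum v (\<lambda>t p. sum_list (map (\<lambda>q. if q = p then 1 else 0) (splits t)))"

definition YEps :: "(tree \<Rightarrow> rat) \<Rightarrow> rat" where
  "YEps v = v Leaf"

text \<open>QSym: vectors in coordinates w.r.t. the basis M_S, indexed by (n, S) with S a subset of [n-1].\<close>
definition qbasis :: "(nat \<times> nat set) set" where
  "qbasis = {(n, S). S \<subseteq> {1..<n}}"

definition QVec :: "(nat \<times> nat set \<Rightarrow> rat) set" where
  "QVec = {v. finite (supp v) \<and> supp v \<subseteq> qbasis}"

definition QF :: "nat \<times> nat set \<Rightarrow> (nat \<times> nat set \<Rightarrow> rat)" where
  "QF nS = (\<lambda>(m, T). if m = fst nS \<and> snd nS \<subseteq> T \<and> T \<subseteq> {1..<m} then 1 else 0)"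

definition QCop :: "(nat \<times> nat set \<Rightarrow> rat) \<Rightarrow> ((nat \<times> nat set) \<times> (nat \<times> nat set) \<Rightarrow> rat)" where
  "QCop v = lsum v (\<lambda>(n, S) p. let as = comp_of n S in
      \<Sum>i\<in>{0..length as}. if (set_of_comp (take i as), set_of_comp (drop i as)) = p then 1 else 0)"

definition QEps :: "(nat \<times> nat set \<Rightarrow> rat) \<Rightarrow> rat" where
  "QEps v = v (0, {})"

definition LamMap :: "(nat list \<Rightarrow> rat) \<Rightarrow> (tree \<Rightarrow> rat)" where
  "LamMap v = lsum v (\<lambda>\<sigma>. delta (lam \<sigma>))"

definition LMap :: "(tree \<Rightarrow> rat) \<Rightarrow> (nat \<times> nat set \<Rightarrow> rat)" where
  "LMap v = lsum v (\<lambda>t. QF (nodes t, Lset t))"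

definition DMap :: "(nat list \<Rightarrow> rat) \<Rightarrow> (nat \<times> nat set \<Rightarrow> rat)" where
  "DMap v = lsum v (\<lambda>\<sigma>. QF (length \<sigma>, Des \<sigma>))"

definition CMap :: "(nat \<times> nat set \<Rightarrow> rat) \<Rightarrow> (tree \<Rightarrow> rat)" where
  "CMap v = lsum v (\<lambda>(n, S). YM (Ct n S))"

definition ZMap :: "(nat \<times> nat set \<Rightarrow> rat) \<Rightarrow> (nat list \<Rightarrow> rat)" where
  "ZMap v = lsum v (\<lambda>(n, S). SM (Zp n S))"

definition GamMap :: "(tree \<Rightarrow> rat) \<Rightarrow> (nat list \<Rightarrow> rat)" where
  "GamMap v = lsum (coords YM v) (\<lambda>t. SM (gam t))"

end

theory Submission
  imports Defs
begin

text \<open>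
  The maps \<open>Des \<stileturn> Z\<close>, \<open>L \<stileturn> C\<close> and \<open>\<lambda> \<stileturn> \<gamma>\<close> are Galois connections between the Boolean, Tamari and weak
  orders: in each case \<open>f(y) \<le> x\<close> iff \<open>y \<le> h(x)\<close>, with \<open>h\<close> injective. Since \<open>F\<^sub>y = \<Sum>\<^bsub>y \<le> w\<^esub> M\<^sub>w\<close>, the linear
  map \<open>F\<^sub>y \<mapsto> F\<^bsub>f(y)\<^esub>\<close> sends \<open>M\<^bsub>h(x)\<^esub>\<close> to \<open>M\<^sub>x\<close>, which gives the three splittings and hence injectivity.

  For permutations and for trees, \<open>x \<le> a \<setminus> b\<close> holds iff the two parts of \<open>x\<close>, cut after \<open>|a|\<close> entries (at
  leaf \<open>|a|\<close>), lie below \<open>a\<close> and \<open>b\<close>; by Moebius inversion the coproduct of \<open>M\<^sub>x\<close> is the sum of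
  \<open>M\<^sub>a \<otimes> M\<^sub>b\<close> over \<open>a \<setminus> b = x\<close>. The maps \<open>C\<close> and \<open>\<gamma>\<close> match these factorizations bijectively.

  The Tamari order is compared with the weak order through inversion sets: \<open>s \<le> t\<close> iff
  \<open>Inv(\<gamma>(s)) \<subseteq> Inv(\<gamma>(t))\<close>, and \<open>(i, j)\<close> is an inversion of \<open>\<gamma>(\<lambda>(\<sigma>))\<close> iff some \<open>(k, j)\<close> with \<open>i \<le> k\<close>
  is an inversion of \<open>\<sigma>\<close>.
\<close>

section \<open>Finitely supported vectors\<close>

definition tensor :: "('b \<Rightarrow> rat) \<Rightarrow> ('c \<Rightarrow> rat) \<Rightarrow> 'b \<times> 'c \<Rightarrow> rat" where
  "tensor f g = (\<lambda>(x, y). f x * g y)"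

definition ind :: "'b set \<Rightarrow> 'b \<Rightarrow> rat" where
  "ind D = (\<lambda>x. if x \<in> D then 1 else 0)"

lemma lsum_eq_sum:
  assumes "finite A" "supp c \<subseteq> A"
  shows "lsum c g x = (\<Sum>b\<in>A. c b * g b x)"
  unfolding lsum_def using assms
  by (intro sum.mono_neutral_left) (auto simp: supp_def)

lemma lsum_cong: "(\<And>b. b \<in> supp c \<Longrightarrow> g b = h b) \<Longrightarrow> lsum c g = lsum c h"
  by (simp add: lsum_def)

lemma supp_lsum_subset: "supp (lsum c g) \<subseteq> (\<Union>b\<in>supp c. supp (g b))"
proof
  fix x assume "x \<in> supp (lsum c g)"
  then have "(\<Sum>b\<in>supp c. c b * g b x) \<noteq> 0" by (simp add: supp_def lsum_def)
  then obtain b where "b \<in> supp c" "c b * g b x \<noteq> 0" by (meson sum.not_neutral_contains_not_neutral)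
  then show "x \<in> (\<Union>b\<in>supp c. supp (g b))" by (auto simp: supp_def)
qed

lemma finite_supp_lsum:
  assumes "finite (supp c)" "\<And>b. b \<in> supp c \<Longrightarrow> finite (supp (g b))"
  shows "finite (supp (lsum c g))"
  by (rule finite_subset[OF supp_lsum_subset]) (use assms in auto)

text \<open>Composition of linear extensions. Finiteness places all inner supports in the one finite
  set \<open>?A\<close>, over which the two sums can be interchanged.\<close>

lemma lsum_lsum:
  assumes "finite (supp c)" "\<And>b. b \<in> supp c \<Longrightarrow> finite (supp (g b))"
  shows "lsum (lsum c g) h = lsum c (\<lambda>b. lsum (g b) h)"
proof
  fix x
  let ?A = "\<Union>b\<in>supp c. supp (g b)"
  have fin: "finite ?A" using assms by blast
  have "lsum (lsum c g) h x = (\<Sum>a\<in>?A. (\<Sum>b\<in>supp c. c b * g b a) * h a x)"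
    by (subst lsum_eq_sum[OF fin supp_lsum_subset]) (simp add: lsum_def)
  also have "\<dots> = (\<Sum>b\<in>supp c. \<Sum>a\<in>?A. c b * g b a * h a x)"
    by (simp add: sum_distrib_right sum.swap[of _ _ "supp c"])
  also have "\<dots> = (\<Sum>b\<in>supp c. c b * lsum (g b) h x)"
  proof (intro sum.cong refl)
    fix b assume "b \<in> supp c"
    then have "supp (g b) \<subseteq> ?A" by blast
    from lsum_eq_sum[OF fin this, of h x]
    show "(\<Sum>a\<in>?A. c b * g b a * h a x) = c b * lsum (g b) h x"
      by (simp add: sum_distrib_left mult.assoc)
  qed
  finally show "lsum (lsum c g) h x = lsum c (\<lambda>b. lsum (g b) h) x" by (simp add: lsum_def)
qed

lemma supp_delta [simp]: "supp (delta a) = {a}"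
  by (auto simp: supp_def delta_def)

lemma supp_ind [simp]: "supp (ind D) = D"
  by (auto simp: supp_def ind_def)

lemma lsum_delta [simp]: "lsum (delta a) g = g a"
  by (simp add: lsum_def) (simp add: delta_def)

lemma lsum_ind: "lsum (ind D) g x = (\<Sum>b\<in>D. g b x)"
  by (simp add: lsum_def) (simp add: ind_def)

lemma lsum_delta_right:
  assumes "finite (supp c)"
  shows "lsum c delta = c"
proof
  fix x show "lsum c delta x = c x"
  proof (cases "x \<in> supp c")
    case True
    have "lsum c delta x = (\<Sum>b\<in>supp c. if b = x then c b else 0)"
      by (auto simp: lsum_def delta_def intro!: sum.cong)
    then show ?thesis using True assms by (simp add: sum.delta)
  next
    case False
    then have "lsum c delta x = 0"
      unfolding lsum_def by (intro sum.neutral) (auto simp: delta_def)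
    then show ?thesis using False by (simp add: supp_def)
  qed
qed

lemma supp_tensor [simp]: "supp (tensor v w) = supp v \<times> supp w"
  by (auto simp: supp_def tensor_def)

lemma tensor_delta: "tensor (delta a) (delta b) = delta (a, b)"
  by (auto simp: tensor_def delta_def fun_eq_iff)

lemma lsum_tensor:
  "lsum (tensor v w) (\<lambda>(a, b). tensor (g a) (h b)) = tensor (lsum v g) (lsum w h)"
  by (simp add: fun_eq_iff lsum_def)
    (auto simp: tensor_def sum_product sum.cartesian_product algebra_simps intro!: sum.cong)

lemma tens_eq: "tens f w = lsum w (\<lambda>(a, b). tensor (f (delta a)) (f (delta b)))"
  by (simp add: tens_def tensor_def)

lemma tens_tensor:
  "tens f (tensor v w) = tensor (lsum v (\<lambda>a. f (delta a))) (lsum w (\<lambda>a. f (delta a)))"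
  by (simp add: tens_eq lsum_tensor)

text \<open>Vectors are coordinate functions in a basis \<open>F\<close>; \<open>M x\<close> holds the \<open>F\<close>-coordinates of the
  vector \<open>M\<^sub>x\<close>, and \<open>z x\<close> the \<open>M\<close>-coordinates of \<open>F\<^sub>x\<close>.\<close>
locale zeta_basis =
  fixes B :: "'b set" and z M :: "'b \<Rightarrow> 'b \<Rightarrow> rat"
  assumes finite_z: "x \<in> B \<Longrightarrow> finite (supp (z x))" and supp_z: "x \<in> B \<Longrightarrow> supp (z x) \<subseteq> B"
    and finite_M: "x \<in> B \<Longrightarrow> finite (supp (M x))" and supp_M: "x \<in> B \<Longrightarrow> supp (M x) \<subseteq> B"
    and z_M: "x \<in> B \<Longrightarrow> lsum (z x) M = delta x"
    and M_z: "x \<in> B \<Longrightarrow> lsum (M x) z = delta x"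
begin

definition V :: "('b \<Rightarrow> rat) set" where
  "V = {v. finite (supp v) \<and> supp v \<subseteq> B}"

lemma finite_V: "v \<in> V \<Longrightarrow> finite (supp v)"
  by (simp add: V_def)

lemma V_supp: "v \<in> V \<Longrightarrow> x \<in> supp v \<Longrightarrow> x \<in> B"
  by (auto simp: V_def)

lemma z_in_V: "x \<in> B \<Longrightarrow> z x \<in> V"
  by (simp add: V_def finite_z supp_z)

lemma lsum_in_V:
  assumes "finite (supp v)" "\<And>x. x \<in> supp v \<Longrightarrow> g x \<in> V"
  shows "lsum v g \<in> V"
  unfolding V_def
proof (intro CollectI conjI)
  show "finite (supp (lsum v g))" using assms by (intro finite_supp_lsum finite_V) auto
  show "supp (lsum v g) \<subseteq> B"
    using supp_lsum_subset[of v g] V_supp[OF assms(2)] by blast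
qed

lemma lsum_z_in_V: "v \<in> V \<Longrightarrow> lsum v z \<in> V"
  by (intro lsum_in_V finite_V z_in_V V_supp[of v])

text \<open>\<open>lsum v z\<close> gives the M-coordinates of the vector \<open>v\<close>;
  expanding them through \<open>M\<close> leads back to \<open>v\<close>, by \<open>z_M\<close> on
  each basis element.\<close>

lemma lsum_z_M:
  assumes v: "v \<in> V"
  shows "lsum (lsum v z) M = v"
proof -
  have "lsum (lsum v z) M = lsum v (\<lambda>x. lsum (z x) M)"
    by (intro lsum_lsum finite_V[OF v] finite_z V_supp[OF v])
  also have "\<dots> = lsum v delta" by (intro lsum_cong z_M V_supp[OF v])
  finally show ?thesis by (simp add: lsum_delta_right finite_V[OF v])
qed

lemma lsum_M_z:
  assumes v: "v \<in> V"
  shows "lsum (lsum v M) z = v"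
proof -
  have "lsum (lsum v M) z = lsum v (\<lambda>x. lsum (M x) z)"
    by (intro lsum_lsum finite_V[OF v] finite_M V_supp[OF v])
  also have "\<dots> = lsum v delta" by (intro lsum_cong M_z V_supp[OF v])
  finally show ?thesis by (simp add: lsum_delta_right finite_V[OF v])
qed

end

text \<open>\<open>dec x\<close> collects the pairs \<open>(a, b)\<close> that occur in the coproduct of \<open>M\<^sub>x\<close>. The last axiom
  compares the \<open>M \<otimes> M\<close>-coordinates of the coproduct of \<open>F\<^sub>x\<close> with those prescribed by
  \<open>F\<^sub>x = \<Sum> M\<^sub>y\<close>.\<close>
locale zeta_coalgebra = zeta_basis +
  fixes cop :: "'a \<Rightarrow> 'a \<times> 'a \<Rightarrow> rat" and dec :: "'a \<Rightarrow> ('a \<times> 'a) set"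
  assumes finite_cop: "x \<in> B \<Longrightarrow> finite (supp (cop x))"
    and supp_cop: "x \<in> B \<Longrightarrow> supp (cop x) \<subseteq> B \<times> B"
    and finite_dec: "x \<in> B \<Longrightarrow> finite (dec x)"
    and dec_subset: "x \<in> B \<Longrightarrow> dec x \<subseteq> B \<times> B"
    and cop_z: "x \<in> B \<Longrightarrow>
      lsum (cop x) (\<lambda>(a, b). tensor (z a) (z b)) = lsum (z x) (\<lambda>y. ind (dec y))"
begin

text \<open>\<open>M\<close> tensor \<open>M\<close> is applied to both sides of
  \<open>cop_z\<close>; on the left it cancels \<open>z\<close> tensor \<open>z\<close> on each
  basis pair.\<close>

lemma cop_eq:
  assumes x: "x \<in> B"
  shows "cop x = lsum (lsum (z x) (\<lambda>y. ind (dec y))) (\<lambda>(a, b). tensor (M a) (M b))"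
proof -
  have "lsum (lsum (cop x) (\<lambda>(a, b). tensor (z a) (z b))) (\<lambda>(a, b). tensor (M a) (M b))
    = lsum (cop x) (\<lambda>p. lsum ((\<lambda>(a, b). tensor (z a) (z b)) p) (\<lambda>(a, b). tensor (M a) (M b)))"
    using supp_cop[OF x] by (intro lsum_lsum) (auto simp: finite_cop x finite_z)
  also have "\<dots> = lsum (cop x) delta"
    using supp_cop[OF x]
    by (intro lsum_cong) (auto simp: lsum_tensor z_M tensor_delta)
  also have "\<dots> = cop x" by (simp add: lsum_delta_right finite_cop x)
  finally show ?thesis by (simp add: cop_z x)
qed

text \<open>Extending \<open>cop_eq\<close> linearly along \<open>M x\<close> collapses the zeta
  coefficients by \<open>M_z\<close>, so only the decompositions of \<open>x\<close> itself
  remain.\<close>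

lemma cop_M:
  assumes x: "x \<in> B"
  shows "lsum (M x) cop = lsum (ind (dec x)) (\<lambda>(a, b). tensor (M a) (M b))"
proof -
  have fin: "y \<in> B \<Longrightarrow> finite (supp (lsum (z y) (\<lambda>y. ind (dec y))))" for y
    using supp_z[of y] by (intro finite_supp_lsum) (auto simp: finite_z intro!: finite_dec)
  have "lsum (M x) cop
    = lsum (M x) (\<lambda>y. lsum (lsum (z y) (\<lambda>y. ind (dec y))) (\<lambda>(a, b). tensor (M a) (M b)))"
    using supp_M[OF x] by (intro lsum_cong cop_eq) auto
  also have "\<dots> = lsum (lsum (M x) (\<lambda>y. lsum (z y) (\<lambda>y. ind (dec y)))) (\<lambda>(a, b). tensor (M a) (M b))"
    using supp_M[OF x] by (intro lsum_lsum[symmetric]) (auto simp: finite_M x intro!: fin)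
  also have "lsum (M x) (\<lambda>y. lsum (z y) (\<lambda>y. ind (dec y))) = lsum (lsum (M x) z) (\<lambda>y. ind (dec y))"
    using supp_M[OF x] by (intro lsum_lsum[symmetric]) (auto simp: finite_M x intro!: finite_z)
  finally show ?thesis by (simp add: M_z x)
qed

lemma cop_V:
  assumes c: "c \<in> V"
  shows "lsum (lsum c M) cop = lsum c (\<lambda>x. lsum (ind (dec x)) (\<lambda>(a, b). tensor (M a) (M b)))"
proof -
  have "lsum (lsum c M) cop = lsum c (\<lambda>x. lsum (M x) cop)"
    by (intro lsum_lsum finite_V[OF c] finite_M V_supp[OF c])
  also have "\<dots> = lsum c (\<lambda>x. lsum (ind (dec x)) (\<lambda>(a, b). tensor (M a) (M b)))"
    by (intro lsum_cong cop_M V_supp[OF c])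
  finally show ?thesis .
qed

end

section \<open>Embeddings of bases and of coalgebras\<close>

locale zeta_embedding =
  src: zeta_basis B1 z1 M1 + tgt: zeta_basis B2 z2 M2
  for B1 :: "'b set" and z1 M1 and B2 :: "'c set" and z2 M2 +
  fixes h :: "'b \<Rightarrow> 'c"
  assumes h_in: "x \<in> B1 \<Longrightarrow> h x \<in> B2" and h_inj: "inj_on h B1"
begin

text \<open>The hypothesis on \<open>g\<close> says \<open>g(F\<^sub>y) = \<Sum> M\<^sub>x\<close> over all \<open>x\<close> with \<open>y \<le> h x\<close>. Expanding \<open>F\<^sub>y\<close> in the
  \<open>M\<close>-basis shows that \<open>g\<close> sends \<open>M\<^bsub>h x\<^esub>\<close> to \<open>M\<^sub>x\<close>.\<close>
lemma splitting:
  assumes g: "\<And>y. y \<in> B2 \<Longrightarrow> g y = lsum (\<lambda>x. if x \<in> B1 then z2 y (h x) else 0) M1"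
    and x: "x \<in> B1"
  shows "lsum (M2 (h x)) g = M1 x"
proof -
  let ?w = "\<lambda>y x. if x \<in> B1 then z2 y (h x) else 0"
  have fin: "finite (supp (?w y))" if "y \<in> B2" for y
  proof (rule inj_on_finite[of h _ "supp (z2 y)"])
    show "inj_on h (supp (?w y))" using h_inj by (rule inj_on_subset) (auto simp: supp_def)
    show "h ` supp (?w y) \<subseteq> supp (z2 y)" by (auto simp: supp_def split: if_splits)
    show "finite (supp (z2 y))" using that by (rule tgt.finite_z)
  qed
  have sub: "supp (M2 (h x)) \<subseteq> B2" by (intro tgt.supp_M h_in x)
  have "lsum (M2 (h x)) g = lsum (M2 (h x)) (\<lambda>y. lsum (?w y) M1)"
    using sub by (intro lsum_cong g) auto
  also have "\<dots> = lsum (lsum (M2 (h x)) ?w) M1"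
    using sub by (intro lsum_lsum[symmetric] fin) (auto simp: tgt.finite_M h_in x)
  \<comment> \<open>The coefficient at \<open>x'\<close> in \<open>B1\<close> is the entry of the
    product of \<open>M2\<close> and \<open>z2\<close> at the pair \<open>h x\<close>,
    \<open>h x'\<close>; it is 1 only for \<open>h x' = h x\<close>, that is
    \<open>x' = x\<close>.\<close>
  also have "lsum (M2 (h x)) ?w = delta x"
  proof
    fix x'
    have "lsum (M2 (h x)) ?w x' = (if x' \<in> B1 then lsum (M2 (h x)) z2 (h x') else 0)"
      by (simp add: lsum_def)
    also have "\<dots> = delta x x'"
      using h_inj x by (auto simp: tgt.M_z h_in delta_def inj_on_def)
    finally show "lsum (M2 (h x)) ?w x' = delta x x'" .
  qed
  finally show ?thesis by simp
qed

lemma splitting_lsum: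
  assumes g: "\<And>y. y \<in> B2 \<Longrightarrow> g y = lsum (\<lambda>x. if x \<in> B1 then z2 y (h x) else 0) M1"
    and c: "c \<in> src.V"
  shows "lsum (lsum c (\<lambda>x. M2 (h x))) g = lsum c M1"
proof -
  have "lsum (lsum c (\<lambda>x. M2 (h x))) g = lsum c (\<lambda>x. lsum (M2 (h x)) g)"
    by (intro lsum_lsum src.finite_V[OF c] tgt.finite_M h_in src.V_supp[OF c])
  also have "\<dots> = lsum c M1"
    by (intro lsum_cong splitting[OF g] src.V_supp[OF c])
  finally show ?thesis .
qed

end

locale zeta_coalgebra_embedding =
  src: zeta_coalgebra B1 z1 M1 cop1 dec1 + tgt: zeta_coalgebra B2 z2 M2 cop2 dec2
  + zeta_embedding B1 z1 M1 B2 z2 M2 h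
  for B1 :: "'b set" and z1 M1 cop1 dec1 and B2 :: "'c set" and z2 M2 cop2 dec2 and h +
  assumes dec_h: "x \<in> B1 \<Longrightarrow> dec2 (h x) = map_prod h h ` dec1 x"
begin

text \<open>The hypothesis on \<open>f\<close> makes it the linear map sending \<open>M1 x\<close>
  to \<open>M2 (h x)\<close>. By \<open>dec_h\<close> and injectivity of \<open>h\<close>, the
  coproduct of \<open>M2 (h x)\<close> is the image of that of \<open>M1 x\<close>, term by
  term.\<close>

lemma coalgebra_morphism:
  assumes f: "\<And>v. v \<in> src.V \<Longrightarrow> f v = lsum (lsum v z1) (\<lambda>x. M2 (h x))"
    and v: "v \<in> src.V"
  shows "lsum (f v) cop2 = tens f (lsum v cop1)"
proof -
  have f_delta: "f (delta x) = lsum (z1 x) (\<lambda>x. M2 (h x))" if "x \<in> B1" for x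
    using that by (subst f) (auto simp: src.V_def)
  have f_M: "lsum (M1 x) (\<lambda>a. f (delta a)) = M2 (h x)" if x: "x \<in> B1" for x
  proof -
    have "lsum (M1 x) (\<lambda>a. f (delta a)) = lsum (M1 x) (\<lambda>a. lsum (z1 a) (\<lambda>x. M2 (h x)))"
      using src.supp_M[OF x] by (intro lsum_cong f_delta) auto
    also have "\<dots> = lsum (lsum (M1 x) z1) (\<lambda>x. M2 (h x))"
      using src.supp_M[OF x] by (intro lsum_lsum[symmetric]) (auto simp: src.finite_M x intro!: src.finite_z)
    finally show ?thesis by (simp add: src.M_z x)
  qed
  define c where "c = lsum v z1"
  have c: "c \<in> src.V" unfolding c_def by (rule src.lsum_z_in_V[OF v])
  have supp_c: "x \<in> B1" if "x \<in> supp c" for x using c that by (auto simp: src.V_def)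
  have finc: "finite (supp c)" using c by (auto simp: src.V_def)
  have "lsum (f v) cop2 = lsum c (\<lambda>x. lsum (M2 (h x)) cop2)"
    unfolding f[OF v] c_def[symmetric]
    by (rule lsum_lsum[OF finc]) (auto intro!: tgt.finite_M h_in supp_c)
  also have "\<dots> = lsum c (\<lambda>x. lsum (ind (dec1 x)) (\<lambda>(a, b). tensor (M2 (h a)) (M2 (h b))))"
  proof (rule lsum_cong)
    fix x assume "x \<in> supp c"
    then have x: "x \<in> B1" by (rule supp_c)
    have inj: "inj_on (map_prod h h) (dec1 x)"
      using map_prod_inj_on[OF h_inj h_inj] src.dec_subset[OF x] by (rule inj_on_subset)
    show "lsum (M2 (h x)) cop2 = lsum (ind (dec1 x)) (\<lambda>(a, b). tensor (M2 (h a)) (M2 (h b)))"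
      unfolding tgt.cop_M[OF h_in[OF x]] dec_h[OF x]
      by (rule ext) (auto simp: lsum_ind sum.reindex[OF inj] intro!: sum.cong)
  qed
  also have "\<dots> = lsum c (\<lambda>x. tens f (lsum (ind (dec1 x)) (\<lambda>(a, b). tensor (M1 a) (M1 b))))"
  proof (rule lsum_cong)
    fix x assume "x \<in> supp c"
    then have x: "x \<in> B1" by (rule supp_c)
    have "tens f (lsum (ind (dec1 x)) (\<lambda>(a, b). tensor (M1 a) (M1 b)))
      = lsum (ind (dec1 x)) (\<lambda>p. tens f ((\<lambda>(a, b). tensor (M1 a) (M1 b)) p))"
      unfolding tens_eq[of f] using src.dec_subset[OF x]
      by (intro lsum_lsum) (auto simp: src.finite_dec x intro!: src.finite_M finite_cartesian_product)
    also have "\<dots> = lsum (ind (dec1 x)) (\<lambda>(a, b). tensor (M2 (h a)) (M2 (h b)))"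
      using src.dec_subset[OF x] by (intro lsum_cong) (auto simp: tens_tensor f_M subset_iff)
    finally show "lsum (ind (dec1 x)) (\<lambda>(a, b). tensor (M2 (h a)) (M2 (h b)))
      = tens f (lsum (ind (dec1 x)) (\<lambda>(a, b). tensor (M1 a) (M1 b)))" by simp
  qed
  also have "\<dots> = tens f (lsum c (\<lambda>x. lsum (ind (dec1 x)) (\<lambda>(a, b). tensor (M1 a) (M1 b))))"
    unfolding tens_eq[of f]
  proof (rule lsum_lsum[symmetric, OF finc])
    fix x assume "x \<in> supp c"
    then have x: "x \<in> B1" by (rule supp_c)
    show "finite (supp (lsum (ind (dec1 x)) (\<lambda>(a, b). tensor (M1 a) (M1 b))))"
      using src.dec_subset[OF x]
      by (intro finite_supp_lsum) (auto simp: src.finite_dec x intro!: src.finite_M finite_cartesian_product)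
  qed
  also have "\<dots> = tens f (lsum v cop1)"
    unfolding src.cop_V[OF c, symmetric] unfolding c_def src.lsum_z_M[OF v] ..
  finally show ?thesis .
qed

text \<open>The counits read the coefficients at \<open>e1\<close> and \<open>e2\<close>, which are
  to be the basis elements of degree 0. By the two conditions on them, both counits pick the
  M-coordinate of \<open>v\<close> at \<open>e1\<close>.\<close>

lemma coalg_hom:
  assumes f: "\<And>v. v \<in> src.V \<Longrightarrow> f v = lsum (lsum v z1) (\<lambda>x. M2 (h x))"
    and e1: "\<And>x. x \<in> B1 \<Longrightarrow> z1 x e1 = (if x = e1 then 1 else 0)"
    and e2: "\<And>x. x \<in> B1 \<Longrightarrow> M2 (h x) e2 = (if x = e1 then 1 else 0)"
  shows "coalg_hom src.V (\<lambda>v. lsum v cop1) (\<lambda>v. v e1) (\<lambda>v. lsum v cop2) (\<lambda>v. v e2) f"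
  unfolding coalg_hom_def
proof (intro ballI conjI)
  fix v assume v: "v \<in> src.V"
  show "lsum (f v) cop2 = tens f (lsum v cop1)"
    using f v by (rule coalgebra_morphism)
  have pick: "lsum c g e = c e1" if "c \<in> src.V" "\<And>x. x \<in> B1 \<Longrightarrow> g x e = (if x = e1 then 1 else 0)"
    for c :: "'b \<Rightarrow> rat" and g :: "'b \<Rightarrow> 'd \<Rightarrow> rat" and e
  proof -
    have "lsum c g e = lsum c delta e1"
      using that unfolding lsum_def
      by (intro sum.cong) (auto simp: src.V_def subset_iff delta_def)
    then show ?thesis using that by (simp add: lsum_delta_right src.finite_V)
  qed
  have "f v e2 = lsum v z1 e1" unfolding f[OF v]
    by (rule pick[OF src.lsum_z_in_V[OF v]]) (rule e2)
  also have "\<dots> = v e1" by (rule pick[OF v]) (rule e1)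
  finally show "f v e2 = v e1" .
qed

end

section \<open>Moebius inversion in graded posets\<close>

locale fin_poset =
  fixes P :: "'a set" and le :: "'a \<Rightarrow> 'a \<Rightarrow> bool"
  assumes fin: "finite P" and le_refl: "x \<in> P \<Longrightarrow> le x x"
    and le_antisym: "x \<in> P \<Longrightarrow> y \<in> P \<Longrightarrow> le x y \<Longrightarrow> le y x \<Longrightarrow> x = y"
    and le_trans: "x \<in> P \<Longrightarrow> y \<in> P \<Longrightarrow> w \<in> P \<Longrightarrow> le x y \<Longrightarrow> le y w \<Longrightarrow> le x w"
begin

lemma fin_poset_dual: "fin_poset P (\<lambda>x y. le y x)"
proof
  fix x y w assume "x \<in> P" "y \<in> P" "w \<in> P" "le y x" "le w y"
  then show "le w x" by (intro le_trans[of w y x])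
qed (auto intro: fin le_refl le_antisym)

text \<open>Along a strict relation the number of elements below strictly grows, by transitivity and
  antisymmetry.\<close>

lemma wf_strict: "wf {(x, y). x \<in> P \<and> y \<in> P \<and> le x y \<and> x \<noteq> y}" (is "wf ?R")
proof (rule wf_subset)
  show "?R \<subseteq> measure (\<lambda>y. card {x \<in> P. le x y})"
  proof clarsimp
    fix x y assume "x \<in> P" "y \<in> P" "le x y" "x \<noteq> y"
    moreover from this have "{u \<in> P. le u x} \<subseteq> {u \<in> P. le u y}"
      by (auto intro: le_trans[of _ x y])
    moreover have "y \<in> {u \<in> P. le u y}" "y \<notin> {u \<in> P. le u x}"
      using calculation le_refl[of y] le_antisym[of x y] by auto
    ultimately show "card {u \<in> P. le u x} < card {u \<in> P. le u y}"
      using fin by (intro psubset_card_mono) auto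
  qed
qed simp

text \<open>\<open>mobius\<close> is a definite description. Its recursion runs along the second
  argument, so well-founded recursion gives a solution and well-founded induction shows that it is
  the only one.\<close>

lemma mobius_unfold:
  "mobius P le x y = (if x \<in> P \<and> y \<in> P \<and> le x y
      then (if x = y then 1 else - (\<Sum>w\<in>{w\<in>P. le x w \<and> le w y \<and> w \<noteq> y}. mobius P le x w))
      else 0)"
proof -
  let ?E = "\<lambda>f :: 'a \<Rightarrow> 'a \<Rightarrow> int. \<forall>x y. f x y = (if x \<in> P \<and> y \<in> P \<and> le x y
      then (if x = y then 1 else - (\<Sum>w\<in>{w\<in>P. le x w \<and> le w y \<and> w \<noteq> y}. f x w))
      else 0)"
  let ?R = "{(x, y). x \<in> P \<and> y \<in> P \<and> le x y \<and> x \<noteq> y}"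
  let ?F = "\<lambda>x (g :: 'a \<Rightarrow> int) y. if x \<in> P \<and> y \<in> P \<and> le x y
      then (if x = y then 1 else - (\<Sum>w\<in>{w\<in>P. le x w \<and> le w y \<and> w \<noteq> y}. g w)) else 0"
  have ex: "?E (\<lambda>x. wfrec ?R (?F x))"
  proof (intro allI)
    fix x y
    show "wfrec ?R (?F x) y = ?F x (wfrec ?R (?F x)) y"
      by (subst wfrec[OF wf_strict]) (auto intro!: sum.cong simp: cut_apply)
  qed
  have uniq: "f = g" if f: "?E f" and g: "?E g" for f g
  proof (intro ext)
    fix x y
    show "f x y = g x y"
    proof (induction y rule: wf_induct_rule[OF wf_strict])
      case (1 y)
      have "f x w = g x w" if "y \<in> P" "w \<in> {w \<in> P. le x w \<and> le w y \<and> w \<noteq> y}" for w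
        using 1 that by auto
      then have "y \<in> P \<Longrightarrow> (\<Sum>w\<in>{w\<in>P. le x w \<and> le w y \<and> w \<noteq> y}. f x w)
          = (\<Sum>w\<in>{w\<in>P. le x w \<and> le w y \<and> w \<noteq> y}. g x w)"
        by (intro sum.cong) auto
      then show ?case
        unfolding f[rule_format, of x y] g[rule_format, of x y] by (simp split: if_split)
    qed
  qed
  have "?E (mobius P le)"
    unfolding mobius_def by (rule theI[of ?E, OF ex]) (rule uniq[OF _ ex])
  then show ?thesis by blast
qed

lemma mobius_outside: "\<not> (x \<in> P \<and> y \<in> P \<and> le x y) \<Longrightarrow> mobius P le x y = 0"
  by (subst mobius_unfold) (rule if_not_P)

lemma mobius_sum:
  assumes x: "x \<in> P" and y: "y \<in> P"
  shows "(\<Sum>w | w \<in> P \<and> le x w \<and> le w y. mobius P le x w) = (if x = y then 1 else 0)"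
proof (cases "le x y")
  case True
  let ?I = "{w \<in> P. le x w \<and> le w y \<and> w \<noteq> y}"
  have I: "{w. w \<in> P \<and> le x w \<and> le w y} = insert y ?I" using True y le_refl[of y] by auto
  have "(\<Sum>w | w \<in> P \<and> le x w \<and> le w y. mobius P le x w) = mobius P le x y + (\<Sum>w\<in>?I. mobius P le x w)"
    unfolding I using fin by (subst sum.insert) auto
  \<comment> \<open>For \<open>x = y\<close> the half-open interval is empty by antisymmetry;
    otherwise the recursion makes its sum cancel the top term.\<close>
  moreover have "(\<Sum>w\<in>?I. mobius P le x w) = 0" if "x = y"
    using that y le_antisym[of _ y] by (intro sum.neutral) auto
  ultimately show ?thesis using True x y mobius_unfold[of x y]
    by (cases "x = y") simp_all
next
  case False
  then have "{w. w \<in> P \<and> le x w \<and> le w y} = {}" using x y le_trans[of x _ y] by blast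
  moreover have "x \<noteq> y" using False x le_refl by auto
  ultimately show ?thesis by (simp only: sum.empty if_False)
qed

text \<open>A left and a right inverse of the zeta function coincide.\<close>
lemma mobius_dual:
  assumes x: "x \<in> P" and y: "y \<in> P"
  shows "mobius P (\<lambda>x y. le y x) y x = mobius P le x y"
proof -
  interpret dual: fin_poset P "\<lambda>x y. le y x" by (rule fin_poset_dual)
  let ?m = "mobius P le" and ?n = "mobius P (\<lambda>x y. le y x)"
  have m: "(\<Sum>u\<in>P. ?m x u * (if le u w then 1 else 0)) = (if x = w then 1 else 0)" if "w \<in> P" for w
  proof -
    have "(\<Sum>u\<in>P. ?m x u * (if le u w then 1 else 0)) = (\<Sum>u | u \<in> P \<and> le x u \<and> le u w. ?m x u)"
      using fin mobius_outside[of x] by (intro sum.mono_neutral_cong_right) auto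
    then show ?thesis by (simp add: mobius_sum x that)
  qed
  have n: "(\<Sum>w\<in>P. (if le u w then 1 else 0) * ?n y w) = (if u = y then 1 else 0)" if "u \<in> P" for u
  proof -
    have "(\<Sum>w\<in>P. (if le u w then 1 else 0) * ?n y w) = (\<Sum>w | w \<in> P \<and> le w y \<and> le u w. ?n y w)"
      using fin dual.mobius_outside[of y] by (intro sum.mono_neutral_cong_right) auto
    then show ?thesis using dual.mobius_sum[OF y that] by auto
  qed
  \<comment> \<open>With \<open>?n\<close> read as a transposed matrix, this is associativity of the
    product of \<open>?m\<close>, the zeta matrix and \<open>?n\<close>; the facts \<open>m\<close>
    and \<open>n\<close> evaluate the two bracketings.\<close>
  have "?n y x = (\<Sum>w\<in>P. (\<Sum>u\<in>P. ?m x u * (if le u w then 1 else 0)) * ?n y w)"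
    using fin x by (simp add: m if_distrib[of "\<lambda>a. a * _"] cong: if_cong)
  also have "\<dots> = (\<Sum>u\<in>P. ?m x u * (\<Sum>w\<in>P. (if le u w then 1 else 0) * ?n y w))"
    unfolding sum_distrib_left sum_distrib_right mult.assoc by (rule sum.swap)
  also have "\<dots> = ?m x y"
    using fin y by (simp add: n if_distrib[of "\<lambda>a. _ * a"] cong: if_cong)
  finally show ?thesis .
qed

lemma mobius_sum_right:
  assumes x: "x \<in> P" and y: "y \<in> P"
  shows "(\<Sum>w | w \<in> P \<and> le x w \<and> le w y. mobius P le w y) = (if x = y then 1 else 0)"
proof -
  interpret dual: fin_poset P "\<lambda>x y. le y x" by (rule fin_poset_dual)
  have "(\<Sum>w | w \<in> P \<and> le x w \<and> le w y. mobius P le w y)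
     = (\<Sum>w | w \<in> P \<and> le w y \<and> le x w. mobius P (\<lambda>x y. le y x) y w)"
    by (intro sum.cong) (auto simp: mobius_dual y)
  then show ?thesis by (simp add: dual.mobius_sum x y)
qed

end

section \<open>Moebius bases and coproducts of graded posets\<close>

locale graded_poset =
  fixes B :: "'b set" and deg :: "'b \<Rightarrow> nat" and le :: "'b \<Rightarrow> 'b \<Rightarrow> bool"
  assumes poset: "fin_poset {x \<in> B. deg x = n} le"
begin

text \<open>Degrees are compared explicitly because \<open>le\<close> may relate elements of
  different degree, as \<open>wle\<close> does for permutations of different length.\<close>

definition zeta :: "'b \<Rightarrow> 'b \<Rightarrow> rat" where
  "zeta x y = (if x \<in> B \<and> y \<in> B \<and> deg x = deg y \<and> le x y then 1 else 0)"

definition Mb :: "'b \<Rightarrow> 'b \<Rightarrow> rat" where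
  "Mb x y = of_int (mobius {y \<in> B. deg y = deg x} le x y)"

lemma Mb_deg: "\<not> (y \<in> B \<and> deg y = deg x) \<Longrightarrow> Mb x y = 0"
  unfolding Mb_def by (subst fin_poset.mobius_outside[OF poset]) auto

lemma Mb_self: "x \<in> B \<Longrightarrow> Mb x x = 1"
  unfolding Mb_def by (subst fin_poset.mobius_unfold[OF poset]) (simp add: fin_poset.le_refl[OF poset])

text \<open>The two inversion axioms are the two convolution identities: \<open>z_M\<close> is
  \<open>mobius_sum_right\<close> and \<open>M_z\<close> is \<open>mobius_sum\<close>, each taken in
  a single degree.\<close>

sublocale zeta_basis B zeta Mb
proof
  have fin: "finite {y \<in> B. deg y = n}" for n using fin_poset.fin[OF poset] .
  have sz: "supp (zeta x) \<subseteq> {y \<in> B. deg y = deg x}" for x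
    by (auto simp: supp_def zeta_def split: if_splits)
  have sM: "supp (Mb x) \<subseteq> {y \<in> B. deg y = deg x}" for x
    using Mb_deg by (force simp: supp_def)
  fix x assume x: "x \<in> B"
  let ?P = "{y \<in> B. deg y = deg x}"
  show "finite (supp (zeta x))" "finite (supp (Mb x))"
    using finite_subset[OF sz fin] finite_subset[OF sM fin] by blast+
  show "supp (zeta x) \<subseteq> B" "supp (Mb x) \<subseteq> B" using sz[of x] sM[of x] by auto
  show "lsum (zeta x) Mb = delta x"
  proof
    fix y
    have 1: "lsum (zeta x) Mb y = (\<Sum>w\<in>?P. zeta x w * Mb w y)"
      by (rule lsum_eq_sum[OF fin sz])
    show "lsum (zeta x) Mb y = delta x y"
    proof (cases "y \<in> ?P")
      case True
      have "(\<Sum>w\<in>?P. zeta x w * Mb w y)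
        = (\<Sum>w | w \<in> ?P \<and> le x w \<and> le w y. of_int (mobius ?P le w y))"
        using fin x by (intro sum.mono_neutral_cong_right)
          (auto simp: zeta_def Mb_def fin_poset.mobius_outside[OF poset])
      also have "\<dots> = of_int (\<Sum>w | w \<in> ?P \<and> le x w \<and> le w y. mobius ?P le w y)" by simp
      also have "\<dots> = delta x y"
        using True x by (subst fin_poset.mobius_sum_right[OF poset]) (auto simp: delta_def)
      finally show ?thesis using 1 by simp
    next
      case False
      then have "(\<Sum>w\<in>?P. zeta x w * Mb w y) = 0"
        by (intro sum.neutral) (auto simp: Mb_deg)
      then show ?thesis using 1 False x by (auto simp: delta_def)
    qed
  qed
  show "lsum (Mb x) zeta = delta x"
  proof
    fix y
    have 1: "lsum (Mb x) zeta y = (\<Sum>w\<in>?P. Mb x w * zeta w y)"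
      by (rule lsum_eq_sum[OF fin sM])
    show "lsum (Mb x) zeta y = delta x y"
    proof (cases "y \<in> ?P")
      case True
      have "(\<Sum>w\<in>?P. Mb x w * zeta w y)
        = (\<Sum>w | w \<in> ?P \<and> le x w \<and> le w y. of_int (mobius ?P le x w))"
        using fin x True by (intro sum.mono_neutral_cong_right)
          (auto simp: zeta_def Mb_def intro: ccontr[of "le x _"] fin_poset.mobius_outside[OF poset])
      also have "\<dots> = of_int (\<Sum>w | w \<in> ?P \<and> le x w \<and> le w y. mobius ?P le x w)" by simp
      also have "\<dots> = delta x y"
        using True x by (subst fin_poset.mobius_sum[OF poset]) (auto simp: delta_def)
      finally show ?thesis using 1 by simp
    next
      case False
      then have "(\<Sum>w\<in>?P. Mb x w * zeta w y) = 0"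
        by (intro sum.neutral) (auto simp: zeta_def)
      then show ?thesis using 1 False x by (auto simp: delta_def)
    qed
  qed
qed

text \<open>The coefficient at \<open>(a, b)\<close> of the transformed coproduct counts the cuts of
  \<open>x\<close> whose parts lie below \<open>a\<close> and \<open>b\<close>. By degree only the
  cut at \<open>deg a\<close> can contribute, and \<open>le_sp\<close> turns its condition into
  \<open>x\<close> lying below \<open>op a b\<close>.\<close>

lemma zeta_coalgebraI:
  fixes op :: "'b \<Rightarrow> 'b \<Rightarrow> 'b" and sp :: "'b \<Rightarrow> ('b \<times> 'b) list"
  assumes op: "\<And>a b. a \<in> B \<Longrightarrow> b \<in> B \<Longrightarrow> op a b \<in> B"
    and deg_op: "\<And>a b. a \<in> B \<Longrightarrow> b \<in> B \<Longrightarrow> deg (op a b) = deg a + deg b"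
    and len: "\<And>x. x \<in> B \<Longrightarrow> length (sp x) = Suc (deg x)"
    and spB: "\<And>x p. x \<in> B \<Longrightarrow> p \<le> deg x \<Longrightarrow> sp x ! p \<in> B \<times> B"
    and deg_sp: "\<And>x p. x \<in> B \<Longrightarrow> p \<le> deg x \<Longrightarrow> deg (fst (sp x ! p)) = p \<and> deg (snd (sp x ! p)) = deg x - p"
    and le_sp: "\<And>x a b. x \<in> B \<Longrightarrow> a \<in> B \<Longrightarrow> b \<in> B \<Longrightarrow> deg x = deg a + deg b \<Longrightarrow>
      le x (op a b) \<longleftrightarrow> le (fst (sp x ! deg a)) a \<and> le (snd (sp x ! deg a)) b"
  shows "zeta_coalgebra B zeta Mb (\<lambda>x p. \<Sum>q\<leftarrow>sp x. if q = p then 1 else 0)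
     (\<lambda>x. {(a, b). a \<in> B \<and> b \<in> B \<and> op a b = x})"
proof
  let ?cop = "\<lambda>x p. \<Sum>q\<leftarrow>sp x. if q = p then 1 else (0 :: rat)"
  let ?dec = "\<lambda>x. {(a, b). a \<in> B \<and> b \<in> B \<and> op a b = x}"
  fix x assume x: "x \<in> B"
  have cop: "?cop x = lsum (ind {..deg x}) (\<lambda>p. delta (sp x ! p))"
    by (rule ext) (auto simp: lsum_ind delta_def sum_list_sum_nth len x atLeast0LessThan lessThan_Suc_atMost intro!: sum.cong)
  have sub: "supp (?cop x) \<subseteq> (\<lambda>p. sp x ! p) ` {..deg x}"
    unfolding cop using supp_lsum_subset[of "ind {..deg x}" "\<lambda>p. delta (sp x ! p)"] by auto
  show "finite (supp (?cop x))" by (rule finite_subset[OF sub]) simp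
  show "supp (?cop x) \<subseteq> B \<times> B"
    using sub spB[OF x] by blast
  have fin: "finite {y \<in> B. deg y = n}" for n using fin_poset.fin[OF poset] .
  have "?dec x \<subseteq> (\<Union>p\<in>{..deg x}. {y \<in> B. deg y = p} \<times> {y \<in> B. deg y = deg x - p})"
    by (auto simp: deg_op)
  then show "finite (?dec x)" by (rule finite_subset) (auto intro!: fin)
  show "?dec x \<subseteq> B \<times> B" by auto
  have "lsum (?cop x) (\<lambda>(a, b). tensor (zeta a) (zeta b))
      = lsum (ind {..deg x}) (\<lambda>p. (\<lambda>(a, b). tensor (zeta a) (zeta b)) (sp x ! p))"
    unfolding cop by (subst lsum_lsum) auto
  also have "\<dots> = lsum (zeta x) (\<lambda>y. ind (?dec y))"
  proof
    fix ab :: "'b \<times> 'b"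
    obtain a b where ab: "ab = (a, b)" by fastforce
    let ?l = "\<lambda>p. fst (sp x ! p)" and ?r = "\<lambda>p. snd (sp x ! p)"
    have L: "lsum (ind {..deg x}) (\<lambda>p. (\<lambda>(a, b). tensor (zeta a) (zeta b)) (sp x ! p)) ab
       = (\<Sum>p\<le>deg x. zeta (?l p) a * zeta (?r p) b)"
      by (simp add: lsum_ind ab tensor_def case_prod_unfold)
    have R: "lsum (zeta x) (\<lambda>y. ind (?dec y)) ab = (if a \<in> B \<and> b \<in> B then zeta x (op a b) else 0)"
    proof (cases "a \<in> B \<and> b \<in> B")
      case True
      have "lsum (zeta x) (\<lambda>y. ind (?dec y)) ab = lsum (zeta x) delta (op a b)"
        unfolding lsum_def using True
        by (intro sum.cong) (auto simp: ab ind_def delta_def)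
      then show ?thesis using True by (simp add: lsum_delta_right finite_z x)
    qed (auto simp: lsum_def ind_def ab)
    have Ra: "?l p \<in> B" "?r p \<in> B" if "p \<le> deg x" for p using spB[OF x that] by (auto simp: mem_Times_iff)
    have "(\<Sum>p\<le>deg x. zeta (?l p) a * zeta (?r p) b) = (if a \<in> B \<and> b \<in> B then zeta x (op a b) else 0)"
    proof (cases "a \<in> B \<and> b \<in> B \<and> deg x = deg a + deg b")
      case True
      have "(\<Sum>p\<le>deg x. zeta (?l p) a * zeta (?r p) b)
         = (\<Sum>p\<le>deg x. if p = deg a then zeta (?l p) a * zeta (?r p) b else 0)"
        by (intro sum.cong) (auto simp: zeta_def deg_sp x)
      also have "\<dots> = zeta (?l (deg a)) a * zeta (?r (deg a)) b" using True by simp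
      also have "\<dots> = zeta x (op a b)"
        using True x op deg_op deg_sp[OF x, of "deg a"] le_sp[OF x, of a b] Ra[of "deg a"]
        by (auto simp: zeta_def)
      finally show ?thesis using True by simp
    next
      case False
      then have "(\<Sum>p\<le>deg x. zeta (?l p) a * zeta (?r p) b) = 0"
        by (intro sum.neutral) (auto simp: zeta_def deg_sp x)
      then show ?thesis using False by (auto simp: zeta_def deg_op)
    qed
    then show "lsum (ind {..deg x}) (\<lambda>p. (\<lambda>(a, b). tensor (zeta a) (zeta b)) (sp x ! p)) ab
       = lsum (zeta x) (\<lambda>y. ind (?dec y)) ab" unfolding L R .
  qed
  finally show "lsum (?cop x) (\<lambda>(a, b). tensor (zeta a) (zeta b)) = lsum (zeta x) (\<lambda>y. ind (?dec y))" .
qed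

end

section \<open>Permutations and inversions\<close>

lemma allperms_iff: "\<sigma> \<in> allperms \<longleftrightarrow> set \<sigma> = {1..length \<sigma>}"
  by (simp add: allperms_def is_perm_def)

lemma allperms_distinct: "\<sigma> \<in> allperms \<Longrightarrow> distinct \<sigma>"
  by (simp add: allperms_iff card_distinct)

lemma allperms_nth:
  assumes "\<sigma> \<in> allperms" "i < length \<sigma>"
  shows "1 \<le> \<sigma> ! i" "\<sigma> ! i \<le> length \<sigma>"
  using nth_mem[OF assms(2)] assms(1) by (auto simp: allperms_iff)

lemma perms_eq: "perms n = {\<sigma> \<in> allperms. length \<sigma> = n}"
  by (auto simp: perms_def allperms_def is_perm_def)

lemma finite_perms: "finite {\<sigma> \<in> allperms. length \<sigma> = n}"
  by (rule finite_subset[OF _ finite_lists_length_eq[of "{1..n}" n]]) (auto simp: allperms_iff)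

lemma st_nth: "i < length xs \<Longrightarrow> st xs ! i = card {y \<in> set xs. y \<le> xs ! i}"
  by (simp add: st_def)

lemma st_nth_less_iff:
  assumes "i < length xs" "j < length xs"
  shows "st xs ! i < st xs ! j \<longleftrightarrow> xs ! i < xs ! j"
proof -
  have less: "card {y \<in> set xs. y \<le> u} < card {y \<in> set xs. y \<le> v}" if "u < v" "v \<in> set xs" for u v
  proof (rule psubset_card_mono)
    have "v \<in> {y \<in> set xs. y \<le> v}" "v \<notin> {y \<in> set xs. y \<le> u}" using that by auto
    moreover have "{y \<in> set xs. y \<le> u} \<subseteq> {y \<in> set xs. y \<le> v}" using that by auto
    ultimately show "{y \<in> set xs. y \<le> u} \<subset> {y \<in> set xs. y \<le> v}" by blast
  qed simp
  have "card {y \<in> set xs. y \<le> u} \<le> card {y \<in> set xs. y \<le> v}" if "u \<le> v" for u v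
    using that by (intro card_mono) auto
  then show ?thesis
    using assms less[of "xs ! i" "xs ! j"] by (metis leD leI nth_mem st_nth)
qed

lemma st_in_allperms:
  assumes "distinct xs"
  shows "st xs \<in> allperms"
proof -
  have sub: "set (st xs) \<subseteq> {1..length xs}"
  proof
    fix y assume "y \<in> set (st xs)"
    then obtain x where x: "x \<in> set xs" and y: "y = card {u \<in> set xs. u \<le> x}" by (auto simp: st_def)
    have "y \<noteq> 0" using x unfolding y by (auto simp: card_eq_0_iff)
    moreover have "y \<le> card (set xs)" unfolding y by (rule card_mono) auto
    ultimately show "y \<in> {1..length xs}" using card_length[of xs] by simp
  qed
  have "distinct (st xs)"
    unfolding distinct_conv_nth
  proof (intro allI impI)
    fix i j assume "i < length (st xs)" "j < length (st xs)" "i \<noteq> j"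
    moreover from this assms have "xs ! i \<noteq> xs ! j" by (simp add: nth_eq_iff_index_eq)
    ultimately show "st xs ! i \<noteq> st xs ! j"
      using st_nth_less_iff[of i xs j] st_nth_less_iff[of j xs i] by auto
  qed
  then have "card (set (st xs)) = length xs" by (simp add: distinct_card)
  then have "set (st xs) = {1..length xs}" using sub by (intro card_subset_eq) auto
  then show ?thesis by (simp add: allperms_iff)
qed

lemma st_perm:
  assumes "\<sigma> \<in> allperms"
  shows "st \<sigma> = \<sigma>"
  unfolding st_def
proof (rule map_idI)
  fix x assume "x \<in> set \<sigma>"
  then have "{y \<in> set \<sigma>. y \<le> x} = {1..x}" using assms by (auto simp: allperms_iff)
  then show "card {y \<in> set \<sigma>. y \<le> x} = x" by simp
qed

lemma st_shift: "st (map (\<lambda>x. x + k) xs) = st xs"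
proof -
  have "{y \<in> (\<lambda>x. x + k) ` set xs. y \<le> x + k} = (\<lambda>x. x + k) ` {y \<in> set xs. y \<le> x}" for x by auto
  then have "card {y \<in> (\<lambda>x. x + k) ` set xs. y \<le> x + k} = card {y \<in> set xs. y \<le> x}" for x
    by (simp add: card_image)
  then show ?thesis by (simp add: st_def)
qed

lemma invs_iff: "(i, j) \<in> invs \<sigma> \<longleftrightarrow> i < j \<and> j < length \<sigma> \<and> \<sigma> ! j < \<sigma> ! i"
  by (simp add: invs_def)

lemma invs_st: "invs (st xs) = invs xs"
  by (auto simp: invs_iff st_nth_less_iff)

lemma invs_take: "p \<le> length xs \<Longrightarrow> (i, j) \<in> invs (take p xs) \<longleftrightarrow> j < p \<and> (i, j) \<in> invs xs"
  by (auto simp: invs_iff)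

lemma invs_drop: "p \<le> length xs \<Longrightarrow> (i, j) \<in> invs (drop p xs) \<longleftrightarrow> (i + p, j + p) \<in> invs xs"
  by (auto simp: invs_iff add.commute)

lemma pbs_in_allperms:
  assumes "\<sigma> \<in> allperms" "\<tau> \<in> allperms"
  shows "pbs \<sigma> \<tau> \<in> allperms"
proof -
  have "(\<lambda>x. x + length \<tau>) ` {1..length \<sigma>} = {1 + length \<tau>..length \<sigma> + length \<tau>}"
    by (rule image_add_atLeastAtMost')
  then show ?thesis using assms by (auto simp: pbs_def allperms_iff)
qed

lemma length_pbs [simp]: "length (pbs \<sigma> \<tau>) = length \<sigma> + length \<tau>"
  by (simp add: pbs_def)

lemma pbs_assoc: "pbs (pbs a b) c = pbs a (pbs b c)"
  by (simp add: pbs_def algebra_simps)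

text \<open>Every entry of the shifted first factor exceeds all entries of the second, so all pairs
  across the cut are inversions.\<close>

lemma invs_pbs:
  assumes "\<sigma> \<in> allperms" "\<tau> \<in> allperms"
  shows "(i, j) \<in> invs (pbs \<sigma> \<tau>) \<longleftrightarrow> i < j \<and> j < length \<sigma> + length \<tau> \<and>
    (if j < length \<sigma> then (i, j) \<in> invs \<sigma>
     else i < length \<sigma> \<or> (i - length \<sigma>, j - length \<sigma>) \<in> invs \<tau>)"
proof -
  have "\<tau> ! (j - length \<sigma>) < \<sigma> ! i + length \<tau>"
    if "i < length \<sigma>" "\<not> j < length \<sigma>" "j < length \<sigma> + length \<tau>"
    using allperms_nth(1)[OF assms(1) that(1)] allperms_nth(2)[OF assms(2), of "j - length \<sigma>"] that
    by linarith
  then show ?thesis by (auto simp: invs_iff pbs_def nth_append)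
qed

lemma snoc_in_allperms: "\<sigma> \<in> allperms \<Longrightarrow> \<sigma> @ [Suc (length \<sigma>)] \<in> allperms"
  by (auto simp: allperms_iff)

lemma invs_snoc:
  assumes "\<sigma> \<in> allperms"
  shows "invs (\<sigma> @ [Suc (length \<sigma>)]) = invs \<sigma>"
proof -
  have "(i, j) \<in> invs (\<sigma> @ [Suc (length \<sigma>)]) \<longleftrightarrow> (i, j) \<in> invs \<sigma>" for i j
    using allperms_nth(2)[OF assms, of i] by (auto simp: invs_iff nth_append)
  then show ?thesis by auto
qed

lemma pvee_eq_pbs: "pvee \<sigma> \<tau> = pbs (\<sigma> @ [Suc (length \<sigma>)]) \<tau>"
  by (simp add: pvee_def pbs_def)

text \<open>An entry of a permutation equals the number of positions whose entry is at most as
  large, and these positions can be read off the inversion set.\<close>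

lemma perm_eqI_invs:
  assumes "\<sigma> \<in> allperms" "\<tau> \<in> allperms" "length \<sigma> = length \<tau>" "invs \<sigma> = invs \<tau>"
  shows "\<sigma> = \<tau>"
proof (rule nth_equalityI)
  have val: "\<rho> ! i = card {j. j < length \<rho> \<and> (if j < i then (j, i) \<notin> invs \<rho> else j = i \<or> (i, j) \<in> invs \<rho>)}"
    if \<rho>: "\<rho> \<in> allperms" and i: "i < length \<rho>" for \<rho> i
  proof -
    have d: "distinct \<rho>" by (rule allperms_distinct[OF \<rho>])
    have set: "{j. j < length \<rho> \<and> (if j < i then (j, i) \<notin> invs \<rho> else j = i \<or> (i, j) \<in> invs \<rho>)}
      = {j. j < length \<rho> \<and> \<rho> ! j \<le> \<rho> ! i}" (is "?A = ?B")
    proof (intro Collect_cong conj_cong refl)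
      fix j assume j: "j < length \<rho>"
      show "(if j < i then (j, i) \<notin> invs \<rho> else j = i \<or> (i, j) \<in> invs \<rho>) \<longleftrightarrow> \<rho> ! j \<le> \<rho> ! i"
        using i j nth_eq_iff_index_eq[OF d j i] by (auto simp: invs_iff)
    qed
    have "(!) \<rho> ` ?B = {1..\<rho> ! i}"
    proof -
      have "(!) \<rho> ` ?B = {y \<in> set \<rho>. y \<le> \<rho> ! i}" by (auto simp: in_set_conv_nth)
      then show ?thesis using \<rho> allperms_nth(2)[OF \<rho> i] by (auto simp: allperms_iff)
    qed
    moreover have "inj_on ((!) \<rho>) ?B" using d by (auto simp: inj_on_def nth_eq_iff_index_eq)
    ultimately have "card ?B = \<rho> ! i" by (metis card_atLeastAtMost card_image diff_Suc_1)
    then show ?thesis using set by simp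
  qed
  fix i assume "i < length \<sigma>"
  then show "\<sigma> ! i = \<tau> ! i" using assms val[of \<sigma> i] val[of \<tau> i] by simp
qed (use assms in simp)

section \<open>Inversions of trees and the Tamari order\<close>

lemma length_gam [simp]: "length (gam t) = nodes t"
  by (induction t) (simp_all add: pvee_def)

lemma gam_in_allperms [simp]: "gam t \<in> allperms"
proof (induction t)
  case (Node l r)
  then show ?case using snoc_in_allperms[of "gam l"] by (simp add: pvee_eq_pbs pbs_in_allperms)
qed (simp add: allperms_iff)

lemma gam_tbs: "gam (tbs s t) = pbs (gam s) (gam t)"
  by (induction s) (simp_all add: pvee_eq_pbs pbs_assoc, simp add: pbs_def)

lemma gam_one_t: "gam (one_t n) = idp n"
  by (induction n) (simp_all add: idp_def pvee_def)

lemma nodes_tbs [simp]: "nodes (tbs s t) = nodes s + nodes t"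
  by (induction s) auto

text \<open>With internal nodes numbered from 0 in inorder, a pair \<open>i < j\<close> of nodes is
  an inversion exactly when node \<open>i\<close> is not in the left subtree of node
  \<open>j\<close>.\<close>

definition tinv :: "tree \<Rightarrow> nat \<Rightarrow> nat \<Rightarrow> bool" where
  "tinv t i j \<longleftrightarrow> (i, j) \<in> invs (gam t)"

lemma tinvD: "tinv t i j \<Longrightarrow> i < j \<and> j < nodes t"
  by (auto simp: tinv_def invs_iff)

lemma tinv_Leaf [simp]: "\<not> tinv Leaf i j"
  by (simp add: tinv_def invs_iff)

text \<open>The root has position \<open>nodes l\<close> and carries the maximum. The case
  \<open>j = nodes l\<close> falls under the first branch, where \<open>tinv l i j\<close> is false
  because \<open>j\<close> is out of range; indeed no inversion ends at a maximum.\<close>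

lemma tinv_Node: "tinv (Node l r) i j \<longleftrightarrow> i < j \<and> j \<le> nodes l + nodes r \<and>
    (if j \<le> nodes l then tinv l i j
     else i \<le> nodes l \<or> tinv r (i - Suc (nodes l)) (j - Suc (nodes l)))"
  unfolding tinv_def
  using invs_snoc[of "gam l"] snoc_in_allperms[of "gam l"]
  by (simp add: pvee_eq_pbs invs_pbs less_Suc_eq_le)

lemma tinv_tbs: "tinv (tbs s t) i j \<longleftrightarrow> i < j \<and> j < nodes s + nodes t \<and>
    (if j < nodes s then tinv s i j else i < nodes s \<or> tinv t (i - nodes s) (j - nodes s))"
  by (simp add: tinv_def gam_tbs invs_pbs)

text \<open>The permutations \<open>gam t\<close> avoid the pattern 132.\<close>
lemma tinv_extend: "tinv t k j \<Longrightarrow> i \<le> k \<Longrightarrow> tinv t i j"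
proof (induction t arbitrary: i j k)
  case (Node l r)
  then show ?case
    by (auto simp: tinv_Node split: if_splits)
qed simp

lemma wle_gam_iff: "wle (gam s) (gam t) \<longleftrightarrow> (\<forall>i j. tinv s i j \<longrightarrow> tinv t i j)"
  by (auto simp: wle_def tinv_def)

lemma rot_nodes: "rot s t \<Longrightarrow> nodes s = nodes t"
  by (induction rule: rot.induct) auto

lemma tamari_nodes: "tamari s t \<Longrightarrow> nodes s = nodes t"
  unfolding tamari_def by (induction rule: rtranclp_induct) (auto dest: rot_nodes)

text \<open>A rotation takes \<open>a\<close> and the inner root out of the left subtree of the
  outer root and keeps the node sets of all other left subtrees; hence inversions are only
  gained.\<close>

lemma rot_tinv: "rot s t \<Longrightarrow> tinv s i j \<Longrightarrow> tinv t i j"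
proof (induction arbitrary: i j rule: rot.induct)
  case (1 a b c)
  then show ?case
    by (auto simp: tinv_Node diff_diff_left split: if_splits)
next
  case (2 s s' t)
  then show ?case using rot_nodes[OF 2(1)] by (auto simp: tinv_Node split: if_splits)
next
  case (3 t t' s)
  then show ?case using rot_nodes[OF 3(1)] by (auto simp: tinv_Node split: if_splits)
qed

lemma tamari_tinv: "tamari s t \<Longrightarrow> tinv s i j \<Longrightarrow> tinv t i j"
  unfolding tamari_def by (induction rule: rtranclp_induct) (auto dest: rot_tinv)

lemma tamari_refl: "tamari t t"
  by (simp add: tamari_def)

lemma tamari_trans: "tamari s t \<Longrightarrow> tamari t u \<Longrightarrow> tamari s u"
  unfolding tamari_def by (rule rtranclp_trans)

lemma tamari_left: "tamari s s' \<Longrightarrow> tamari (Node s t) (Node s' t)"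
  unfolding tamari_def
  by (induction rule: rtranclp_induct) (auto intro: rtranclp.rtrancl_into_rtrancl rot.intros)

lemma tamari_right: "tamari t t' \<Longrightarrow> tamari (Node s t) (Node s t')"
  unfolding tamari_def
  by (induction rule: rtranclp_induct) (auto intro: rtranclp.rtrancl_into_rtrancl rot.intros)

text \<open>The hypothesis says that node \<open>p\<close> lies on the leftmost branch, so that it can be rotated up
  to the root.\<close>
lemma tamari_root_at:
  "p < nodes s \<Longrightarrow> \<forall>i<p. \<not> tinv s i p \<Longrightarrow> \<exists>x y. nodes x = p \<and> tamari s (Node x y)
    \<and> (\<forall>i j. tinv x i j \<longrightarrow> tinv s i j) \<and> (\<forall>i j. tinv y i j \<longrightarrow> tinv s (i + Suc p) (j + Suc p))"
proof (induction s)
  case (Node l r)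
  consider "p = nodes l" | "p < nodes l" | "nodes l < p" by linarith
  then show ?case
  proof cases
    case 1
    have "\<forall>i j. tinv l i j \<longrightarrow> tinv (Node l r) i j" by (auto simp: tinv_Node dest: tinvD)
    moreover have "\<forall>i j. tinv r i j \<longrightarrow> tinv (Node l r) (i + Suc p) (j + Suc p)"
      using 1 by (auto simp: tinv_Node dest: tinvD)
    ultimately show ?thesis using 1 tamari_refl by blast
  next
    case 2
    have "\<forall>i<p. \<not> tinv l i p" using Node.prems(2) 2 by (auto simp: tinv_Node)
    from Node.IH(1)[OF 2 this] obtain x y where x: "nodes x = p" and l: "tamari l (Node x y)"
      and xl: "\<forall>i j. tinv x i j \<longrightarrow> tinv l i j"
      and yl: "\<forall>i j. tinv y i j \<longrightarrow> tinv l (i + Suc p) (j + Suc p)" by blast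
    have n: "nodes l = Suc (p + nodes y)" using tamari_nodes[OF l] x by simp
    have "tamari (Node (Node x y) r) (Node x (Node y r))"
      unfolding tamari_def by (auto intro: rot.intros)
    then have "tamari (Node l r) (Node x (Node y r))"
      using tamari_left[OF l] tamari_trans by blast
    moreover have "\<forall>i j. tinv x i j \<longrightarrow> tinv (Node l r) i j"
      using xl tinvD[of l] by (fastforce simp: tinv_Node)
    moreover have "tinv (Node l r) (i + Suc p) (j + Suc p)" if "tinv (Node y r) i j" for i j
      using that yl n by (auto simp: tinv_Node split: if_splits)
    ultimately show ?thesis using x by blast
  next
    case 3
    \<comment> \<open>A node to the right of the root forms an inversion with the root, against the
      hypothesis on \<open>p\<close>.\<close>
    then have "tinv (Node l r) (nodes l) p" using Node.prems(1) by (auto simp: tinv_Node)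
    then show ?thesis using Node.prems(2) 3 by blast
  qed
qed simp

text \<open>Induction on the larger tree: no inversion of it ends at its root, so none of
  \<open>s\<close> ends at this position. That node of \<open>s\<close> is rotated to the root, and
  the subtrees on both sides, having no inversions beyond those of \<open>s\<close>, are compared
  recursively.\<close>

lemma tinv_tamari: "nodes s = nodes t \<Longrightarrow> \<forall>i j. tinv s i j \<longrightarrow> tinv t i j \<Longrightarrow> tamari s t"
proof (induction t arbitrary: s)
  case Leaf
  then show ?case by (cases s) (auto simp: tamari_refl)
next
  case (Node l r)
  have "\<not> tinv (Node l r) i (nodes l)" for i by (auto simp: tinv_Node dest: tinvD)
  then have "\<forall>i<nodes l. \<not> tinv s i (nodes l)" using Node.prems(2) by blast
  moreover have "nodes l < nodes s" using Node.prems(1) by simp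
  ultimately obtain x y where x: "nodes x = nodes l" and s: "tamari s (Node x y)"
    and xs: "\<forall>i j. tinv x i j \<longrightarrow> tinv s i j"
    and ys: "\<forall>i j. tinv y i j \<longrightarrow> tinv s (i + Suc (nodes l)) (j + Suc (nodes l))"
    using tamari_root_at by blast
  have y: "nodes y = nodes r" using tamari_nodes[OF s] x Node.prems(1) by simp
  have "tinv l i j" if "tinv x i j" for i j
    using that xs Node.prems(2) tinvD[OF that] x by (fastforce simp: tinv_Node split: if_splits)
  then have xl: "tamari x l" using Node.IH(1) x by blast
  have "tinv r i j" if "tinv y i j" for i j
  proof -
    have "tinv (Node l r) (i + Suc (nodes l)) (j + Suc (nodes l))" using that ys Node.prems(2) by blast
    then show ?thesis by (simp add: tinv_Node)
  qed
  then have yr: "tamari y r" using Node.IH(2) y by blast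
  show ?case using s tamari_left[OF xl] tamari_right[OF yr] tamari_trans by blast
qed

lemma tamari_iff: "tamari s t \<longleftrightarrow> nodes s = nodes t \<and> wle (gam s) (gam t)"
  using tamari_nodes tamari_tinv tinv_tamari unfolding wle_gam_iff by blast

section \<open>The map \<lambda> and its Galois connection with \<gamma>\<close>

lemma perm_split_max:
  assumes "\<sigma> \<in> allperms" "\<sigma> \<noteq> []"
  obtains u v where "\<sigma> = u @ length \<sigma> # v" "length \<sigma> \<notin> set u"
proof -
  have "length \<sigma> \<in> set \<sigma>" using assms by (auto simp: allperms_iff Suc_le_eq)
  then show ?thesis using that by (metis split_list_first)
qed

lemma lam_split:
  assumes "\<sigma> = u @ length \<sigma> # v" "length \<sigma> \<notin> set u"
  shows "lam \<sigma> = Node (lam (st u)) (lam (st v))"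
proof -
  define n where "n = length \<sigma>"
  have \<sigma>: "\<sigma> = u @ n # v" "n \<notin> set u" using assms n_def by auto
  have ne: "\<sigma> \<noteq> []" using \<sigma> by simp
  have len: "n = Suc (length u + length v)" unfolding n_def by (subst \<sigma>(1)) simp
  have lam: "lam \<sigma> = (let n = length \<sigma>;
         j = min (length (takeWhile (\<lambda>y. y \<noteq> n) \<sigma>)) (length \<sigma> - 1)
     in Node (lam (st (take j \<sigma>))) (lam (st (drop (Suc j) \<sigma>))))"
    using ne by (cases \<sigma>) (simp_all add: Let_def)
  have "takeWhile (\<lambda>y. y \<noteq> n) \<sigma> = u" unfolding \<sigma>(1) using \<sigma>(2) by (subst takeWhile_append2) auto
  then have "lam \<sigma> = Node (lam (st (take (length u) \<sigma>))) (lam (st (drop (Suc (length u)) \<sigma>)))"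
    unfolding lam Let_def n_def[symmetric] using len by (simp add: min_def)
  then show ?thesis using \<sigma> by simp
qed

lemma lam_gam: "lam (gam t) = t"
proof (induction t)
  case (Node l r)
  have "lam (gam (Node l r)) = Node (lam (st (map (\<lambda>x. x + nodes r) (gam l)))) (lam (st (gam r)))"
  proof (rule lam_split)
    show "gam (Node l r) = map (\<lambda>x. x + nodes r) (gam l) @ length (gam (Node l r)) # gam r"
      by (simp add: pvee_def)
    have "set (gam l) = {1..nodes l}" using gam_in_allperms[of l] unfolding allperms_iff by simp
    then show "length (gam (Node l r)) \<notin> set (map (\<lambda>x. x + nodes r) (gam l))"
      unfolding length_gam by auto
  qed
  then show ?case by (simp add: st_shift st_perm Node)
qed simp

lemma gam_inj: "inj gam"
  by (rule inj_on_inverseI[of _ lam]) (rule lam_gam)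

text \<open>Induction along the split at the position \<open>p\<close> of the maximum. No inversion
  ends at \<open>p\<close>, while \<open>(p, j)\<close> is an inversion for every later
  \<open>j\<close> and serves as witness for all \<open>i \<le> p\<close>; the pairs on one side of
  \<open>p\<close> come from \<open>u\<close> or \<open>v\<close>.\<close>

lemma lam_tinv:
  "\<sigma> \<in> allperms \<Longrightarrow> nodes (lam \<sigma>) = length \<sigma> \<and>
     (\<forall>i j. tinv (lam \<sigma>) i j \<longleftrightarrow> (\<exists>k. i \<le> k \<and> (k, j) \<in> invs \<sigma>))"
proof (induction "length \<sigma>" arbitrary: \<sigma> rule: less_induct)
  case less
  show ?case
  proof (cases "\<sigma> = []")
    case False
    obtain u v where \<sigma>: "\<sigma> = u @ length \<sigma> # v" and u: "length \<sigma> \<notin> set u"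
      using perm_split_max[OF less.prems False] .
    define p where "p = length u"
    have len: "length \<sigma> = Suc (p + length v)" using arg_cong[OF \<sigma>, of length] by (simp add: p_def)
    have d: "distinct u" "distinct v" using allperms_distinct[OF less.prems] \<sigma> by (metis distinct_append distinct.simps(2))+
    have u: "u = take p \<sigma>" by (subst \<sigma>) (simp add: p_def)
    have v: "v = drop (Suc p) \<sigma>" by (subst \<sigma>) (simp add: p_def)
    have mx: "\<sigma> ! p = length \<sigma>" by (subst \<sigma>) (simp add: p_def)
    have lam: "lam \<sigma> = Node (lam (st u)) (lam (st v))" by (rule lam_split) fact+
    have IHu: "nodes (lam (st u)) = p" "\<And>i j. tinv (lam (st u)) i j \<longleftrightarrow> (\<exists>k. i \<le> k \<and> (k, j) \<in> invs u)"
      using less.hyps[of "st u"] len st_in_allperms[OF d(1)] by (auto simp: p_def invs_st)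
    have IHv: "nodes (lam (st v)) = length v" "\<And>i j. tinv (lam (st v)) i j \<longleftrightarrow> (\<exists>k. i \<le> k \<and> (k, j) \<in> invs v)"
      using less.hyps[of "st v"] len st_in_allperms[OF d(2)] by (auto simp: invs_st)
    have iu: "(k, j) \<in> invs u \<longleftrightarrow> j < p \<and> (k, j) \<in> invs \<sigma>" for k j
      unfolding u using len by (intro invs_take) simp
    have iv: "(k, j) \<in> invs v \<longleftrightarrow> (k + Suc p, j + Suc p) \<in> invs \<sigma>" for k j
      unfolding v using len by (intro invs_drop) simp
    have ip: "(k, p) \<notin> invs \<sigma>" for k
      using allperms_nth(2)[OF less.prems, of k] mx len by (auto simp: invs_iff)
    have pj: "(p, j) \<in> invs \<sigma>" if "p < j" "j < length \<sigma>" for j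
      using that allperms_nth(2)[OF less.prems that(2)] mx
        nth_eq_iff_index_eq[OF allperms_distinct[OF less.prems], of j p]
      by (auto simp: invs_iff order_le_less)
    have "tinv (lam \<sigma>) i j \<longleftrightarrow> (\<exists>k. i \<le> k \<and> (k, j) \<in> invs \<sigma>)" for i j
    proof -
      have bound: "i < j \<and> j < length \<sigma>" if "i \<le> k" "(k, j) \<in> invs \<sigma>" for k
        using that by (auto simp: invs_iff)
      consider "j \<le> p" | "p < j" "i \<le> p" | "p < j" "p < i" by linarith
      then show ?thesis
      proof cases
        case 1
        then have "tinv (lam \<sigma>) i j \<longleftrightarrow> tinv (lam (st u)) i j"
          unfolding lam tinv_Node IHu(1) IHv(1) by (auto dest: tinvD)
        also have "\<dots> \<longleftrightarrow> (\<exists>k. i \<le> k \<and> (k, j) \<in> invs \<sigma>)"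
          unfolding IHu(2) iu using ip 1 by (auto simp: order_le_less)
        finally show ?thesis .
      next
        case 2
        then have "tinv (lam \<sigma>) i j \<longleftrightarrow> j < length \<sigma>"
          unfolding lam tinv_Node IHu(1) IHv(1) len by auto
        then show ?thesis using 2 pj[of j] bound by blast
      next
        case 3
        then have "tinv (lam \<sigma>) i j \<longleftrightarrow> i < j \<and> j < length \<sigma> \<and> tinv (lam (st v)) (i - Suc p) (j - Suc p)"
          unfolding lam tinv_Node IHu(1) IHv(1) len by auto
        also have "tinv (lam (st v)) (i - Suc p) (j - Suc p) \<longleftrightarrow> (\<exists>k. i - Suc p \<le> k \<and> (k + Suc p, j) \<in> invs \<sigma>)"
          unfolding IHv(2) iv using 3 by simp
        also have "\<dots> \<longleftrightarrow> (\<exists>k. i \<le> k \<and> (k, j) \<in> invs \<sigma>)"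
        proof
          assume "\<exists>k. i - Suc p \<le> k \<and> (k + Suc p, j) \<in> invs \<sigma>"
          then obtain k where "i - Suc p \<le> k" "(k + Suc p, j) \<in> invs \<sigma>" by blast
          then show "\<exists>k. i \<le> k \<and> (k, j) \<in> invs \<sigma>" by (intro exI[of _ "k + Suc p"]) auto
        next
          assume "\<exists>k. i \<le> k \<and> (k, j) \<in> invs \<sigma>"
          then obtain k where "i \<le> k" "(k, j) \<in> invs \<sigma>" by blast
          then show "\<exists>k. i - Suc p \<le> k \<and> (k + Suc p, j) \<in> invs \<sigma>"
            using 3 by (intro exI[of _ "k - Suc p"]) auto
        qed
        finally show ?thesis using bound by blast
      qed
    qed
    moreover have "nodes (lam \<sigma>) = length \<sigma>" by (simp add: lam IHu IHv len)
    ultimately show ?thesis by blast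
  qed (simp add: invs_iff)
qed

lemma nodes_lam: "\<sigma> \<in> allperms \<Longrightarrow> nodes (lam \<sigma>) = length \<sigma>"
  using lam_tinv by blast

text \<open>The inversions of \<open>lam \<sigma>\<close> are those of \<sigma> closed under
  decreasing the first index. The inversions of \<open>gam t\<close> are closed in this way by
  \<open>tinv_extend\<close>, so they contain one set iff they contain the other.\<close>

lemma lam_gam_galois:
  assumes "\<sigma> \<in> allperms" "length \<sigma> = nodes t"
  shows "wle \<sigma> (gam t) \<longleftrightarrow> tamari (lam \<sigma>) t"
proof
  assume w: "wle \<sigma> (gam t)"
  show "tamari (lam \<sigma>) t"
  proof (rule tinv_tamari)
    show "\<forall>i j. tinv (lam \<sigma>) i j \<longrightarrow> tinv t i j"
      using w lam_tinv[OF assms(1)] tinv_extend[of t] unfolding wle_def tinv_def by blast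
  qed (use assms nodes_lam in simp)
next
  assume "tamari (lam \<sigma>) t"
  then show "wle \<sigma> (gam t)"
    unfolding wle_def
  proof (intro subrelI)
    fix i j assume "(i, j) \<in> invs \<sigma>"
    then have "tinv (lam \<sigma>) i j" using lam_tinv[OF assms(1)] by blast
    with \<open>tamari (lam \<sigma>) t\<close> show "(i, j) \<in> invs (gam t)"
      unfolding tinv_def[symmetric] by (rule tamari_tinv)
  qed
qed

section \<open>Splittings of trees, cuts of permutations and factorizations\<close>

lemma length_splits: "length (splits t) = Suc (nodes t)"
  by (induction t) auto

text \<open>Leaf \<open>p\<close> lies between the nodes \<open>p - 1\<close> and \<open>p\<close>
  in inorder, so the splitting separates the first \<open>p\<close> nodes from the rest, and each
  part keeps its own inversions.\<close>

lemma splits_tinv: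
  "p \<le> nodes t \<Longrightarrow> splits t ! p = (a, b) \<Longrightarrow> nodes a = p \<and> nodes b = nodes t - p \<and>
    (\<forall>i j. tinv a i j \<longleftrightarrow> j < p \<and> tinv t i j) \<and> (\<forall>i j. tinv b i j \<longleftrightarrow> tinv t (i + p) (j + p))"
proof (induction t arbitrary: p a b)
  case (Node l r)
  show ?case
  proof (cases "p \<le> nodes l")
    case True
    then obtain b' where s: "splits l ! p = (a, b')" and b: "b = Node b' r"
      using Node.prems by (auto simp: nth_append length_splits split: prod.splits)
    from Node.IH(1)[OF True s] True show ?thesis
      unfolding b by (auto simp: tinv_Node diff_diff_left split: if_splits dest: tinvD)
  next
    case False
    then have q: "p - Suc (nodes l) \<le> nodes r" using Node.prems(1) by simp
    then obtain a' where s: "splits r ! (p - Suc (nodes l)) = (a', b)" and a: "a = Node l a'"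
      using Node.prems False by (auto simp: nth_append length_splits split: prod.splits)
    from Node.IH(2)[OF q s] q False Node.prems(1) show ?thesis
      unfolding a by (auto simp: tinv_Node split: if_splits dest: tinvD)
  qed
qed simp

text \<open>Pairs across the cut are all inversions of \<open>tbs a b\<close> and impose no
  condition; the remaining inversions of \<open>t\<close> are those of the two parts.\<close>

lemma tamari_tbs_iff:
  assumes "nodes t = nodes a + nodes b"
  shows "tamari t (tbs a b) \<longleftrightarrow>
    tamari (fst (splits t ! nodes a)) a \<and> tamari (snd (splits t ! nodes a)) b"
proof -
  obtain t0 t1 where s: "splits t ! nodes a = (t0, t1)" by fastforce
  have *: "nodes t0 = nodes a" "nodes t1 = nodes b" "\<And>i j. tinv t0 i j \<longleftrightarrow> j < nodes a \<and> tinv t i j"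
    "\<And>i j. tinv t1 i j \<longleftrightarrow> tinv t (i + nodes a) (j + nodes a)"
    using splits_tinv[OF _ s] assms by auto
  have "(\<forall>i j. tinv t i j \<longrightarrow> tinv (tbs a b) i j) \<longleftrightarrow>
      (\<forall>i j. tinv t0 i j \<longrightarrow> tinv a i j) \<and> (\<forall>i j. tinv t1 i j \<longrightarrow> tinv b i j)" (is "?L \<longleftrightarrow> ?R")
  proof
    assume L: ?L
    have "tinv a i j" if "j < nodes a" "tinv t i j" for i j
      using L that by (auto simp: tinv_tbs)
    moreover have "tinv b i j" if "tinv t (i + nodes a) (j + nodes a)" for i j
      using L[rule_format, OF that] by (auto simp: tinv_tbs)
    ultimately show ?R using * by blast
  next
    assume R: ?R
    show ?L
    proof (intro allI impI)
      fix i j assume ij: "tinv t i j"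
      have "tinv b (i - nodes a) (j - nodes a)" if "nodes a \<le> i"
        using R * that ij tinvD[OF ij] by simp
      then show "tinv (tbs a b) i j"
        using ij tinvD[OF ij] R * assms unfolding tinv_tbs by (metis linorder_not_le)
    qed
  qed
  then show ?thesis using s * assms by (simp add: tamari_iff wle_gam_iff)
qed

text \<open>The same argument on lists; standardization keeps the inversion sets of the two
  parts.\<close>

lemma wle_pbs_iff:
  assumes "a \<in> allperms" "b \<in> allperms" "length \<sigma> = length a + length b"
  shows "wle \<sigma> (pbs a b) \<longleftrightarrow> wle (st (take (length a) \<sigma>)) a \<and> wle (st (drop (length a) \<sigma>)) b"
proof -
  define p where "p = length a"
  have t: "(i, j) \<in> invs (take p \<sigma>) \<longleftrightarrow> j < p \<and> (i, j) \<in> invs \<sigma>" for i j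
    using assms by (intro invs_take) (simp add: p_def)
  have d: "(i, j) \<in> invs (drop p \<sigma>) \<longleftrightarrow> (i + p, j + p) \<in> invs \<sigma>" for i j
    using assms by (intro invs_drop) (simp add: p_def)
  have "invs \<sigma> \<subseteq> invs (pbs a b) \<longleftrightarrow> invs (take p \<sigma>) \<subseteq> invs a \<and> invs (drop p \<sigma>) \<subseteq> invs b" (is "?L \<longleftrightarrow> ?R")
  proof
    assume L: ?L
    have "(i, j) \<in> invs a" if "j < p" "(i, j) \<in> invs \<sigma>" for i j
      using subsetD[OF L that(2)] that(1) assms by (auto simp: invs_pbs p_def)
    moreover have "(i, j) \<in> invs b" if "(i + p, j + p) \<in> invs \<sigma>" for i j
      using subsetD[OF L that] assms by (auto simp: invs_pbs p_def)
    ultimately show ?R using t d by auto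
  next
    assume R: ?R
    show ?L
    proof clarify
      fix i j assume ij: "(i, j) \<in> invs \<sigma>"
      have "(i, j) \<in> invs a" if "j < p" using R t that ij by blast
      moreover have "(i - p, j - p) \<in> invs b" if "p \<le> i"
      proof -
        have "p \<le> j" using ij that by (simp add: invs_iff)
        then have "(i - p, j - p) \<in> invs (drop p \<sigma>)" using d that ij by simp
        then show ?thesis using R by blast
      qed
      ultimately show "(i, j) \<in> invs (pbs a b)"
        using ij assms by (cases "p \<le> i") (auto simp: invs_pbs p_def invs_iff[of i j \<sigma>])
    qed
  qed
  then show ?thesis by (simp add: wle_def invs_st p_def)
qed

text \<open>Both factors of \<open>gam t\<close> have the inversion sets of the two parts of a splitting of \<open>t\<close>.\<close>
lemma pbs_eq_gam:
  "{(\<rho>, \<tau>). \<rho> \<in> allperms \<and> \<tau> \<in> allperms \<and> pbs \<rho> \<tau> = gam t} = map_prod gam gam ` {(a, b). tbs a b = t}"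
proof (intro equalityI subsetI; clarsimp simp: gam_tbs)
  fix \<rho> \<tau> assume \<rho>: "\<rho> \<in> allperms" and \<tau>: "\<tau> \<in> allperms" and eq: "pbs \<rho> \<tau> = gam t"
  define p where "p = length \<rho>"
  have n: "nodes t = p + length \<tau>" using arg_cong[OF eq, of length] by (simp add: p_def)
  obtain a b where s: "splits t ! p = (a, b)" by fastforce
  have *: "nodes a = p" "nodes b = length \<tau>" "\<And>i j. tinv a i j \<longleftrightarrow> j < p \<and> tinv t i j"
    "\<And>i j. tinv b i j \<longleftrightarrow> tinv t (i + p) (j + p)"
    using splits_tinv[OF _ s] n by auto
  have t: "tinv t i j \<longleftrightarrow> (i, j) \<in> invs (pbs \<rho> \<tau>)" for i j by (simp add: tinv_def eq)
  have "invs \<rho> = invs (gam a)"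
    using *(3) t \<rho> \<tau> by (auto simp: tinv_def[symmetric] invs_pbs p_def invs_iff[of _ _ \<rho>])
  then have a: "\<rho> = gam a" using \<rho> * by (intro perm_eqI_invs) (auto simp: p_def)
  have "invs \<tau> = invs (gam b)"
    using *(4) t \<rho> \<tau> by (auto simp: tinv_def[symmetric] invs_pbs p_def invs_iff[of _ _ \<tau>])
  then have b: "\<tau> = gam b" using \<tau> * by (intro perm_eqI_invs) auto
  have "gam (tbs a b) = gam t" using eq a b by (simp add: gam_tbs)
  then have "tbs a b = t" using gam_inj by (simp add: inj_eq)
  then show "(\<rho>, \<tau>) \<in> map_prod gam gam ` {(a, b). tbs a b = t}" using a b by auto
qed

text \<open>An inner leaf \<open>i\<close> lies between the nodes \<open>i - 1\<close> and
  \<open>i\<close>. It is a left child iff node \<open>i\<close> has no left subtree, that is, node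
  \<open>i - 1\<close> is not in it. The first leaf is a left child and the last one a right child,
  except in \<open>Leaf\<close>, where the flag \<open>d\<close> decides.\<close>

lemma ldirs_nth:
  "i \<le> nodes t \<Longrightarrow> ldirs d t ! i =
    (if i = 0 then t = Leaf \<longrightarrow> d else if i = nodes t then False else tinv t (i - 1) i)"
proof (induction t arbitrary: i d)
  case (Node l r)
  have len: "length (ldirs d t) = Suc (nodes t)" for d t by (induction t arbitrary: d) auto
  show ?case
  proof (cases "i \<le> nodes l")
    case True
    then show ?thesis using Node.IH(1)[of i True]
      by (auto simp: nth_append len tinv_Node dest: tinvD)
  next
    case False
    have "nodes r = 0 \<longleftrightarrow> r = Leaf" by (cases r) auto
    then show ?thesis using False Node.IH(2)[of "i - Suc (nodes l)" False] Node.prems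
      by (auto simp: nth_append len tinv_Node dest: tinvD)
  qed
qed simp

lemma Des_gam: "Des (gam t) = Lset t"
  by (auto simp: Des_def Lset_def ldirs_nth tinv_def invs_iff)

text \<open>Given the inclusion, if \<open>S\<close> has no element from \<open>i + 1\<close> to
  \<open>j\<close>, there is no descent there and \<sigma> is weakly increasing from
  \<open>i\<close> to \<open>j\<close>. Conversely a descent \<open>k\<close> is the inversion of
  the adjacent positions \<open>k - 1\<close> and \<open>k\<close>, which leaves only
  \<open>s = k\<close>.\<close>

lemma Des_subset_iff:
  "Des \<sigma> \<subseteq> S \<longleftrightarrow> (\<forall>i j. (i, j) \<in> invs \<sigma> \<longrightarrow> (\<exists>s\<in>S. i < s \<and> s \<le> j))"
proof
  assume D: "Des \<sigma> \<subseteq> S"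
  show "\<forall>i j. (i, j) \<in> invs \<sigma> \<longrightarrow> (\<exists>s\<in>S. i < s \<and> s \<le> j)"
  proof (intro allI impI)
    fix i j assume ij: "(i, j) \<in> invs \<sigma>"
    show "\<exists>s\<in>S. i < s \<and> s \<le> j"
    proof (rule ccontr)
      assume no: "\<not> (\<exists>s\<in>S. i < s \<and> s \<le> j)"
      have "\<sigma> ! i \<le> \<sigma> ! k" if "i \<le> k" "k \<le> j" for k
        using that
      proof (induction k rule: dec_induct)
        case (step k)
        have "Suc k \<notin> Des \<sigma>" using D no step by auto
        then have "\<sigma> ! k \<le> \<sigma> ! Suc k" using step ij by (auto simp: Des_def invs_iff)
        then show ?case using step by simp
      qed simp
      from this[of j] show False using ij by (simp add: invs_iff)
    qed
  qed
next
  assume R: "\<forall>i j. (i, j) \<in> invs \<sigma> \<longrightarrow> (\<exists>s\<in>S. i < s \<and> s \<le> j)"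
  show "Des \<sigma> \<subseteq> S"
  proof
    fix k assume k: "k \<in> Des \<sigma>"
    then have "(k - 1, k) \<in> invs \<sigma>" by (auto simp: Des_def invs_iff)
    with R obtain s where s: "s \<in> S" "k - 1 < s" "s \<le> k" by blast
    then have "s = k" by linarith
    then show "k \<in> S" using s by simp
  qed
qed

section \<open>Compositions\<close>

definition Zc :: "nat list \<Rightarrow> nat list" where
  "Zc as = foldr (\<lambda>a acc. pbs (idp a) acc) as []"

definition Cc :: "nat list \<Rightarrow> tree" where
  "Cc as = foldr (\<lambda>a acc. tbs (one_t a) acc) as Leaf"

definition psums :: "nat list \<Rightarrow> nat set" where
  "psums as = {sum_list (take i as) | i. 1 \<le> i \<and> i < length as}"

lemma set_of_comp_eq: "set_of_comp as = (sum_list as, psums as)"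
  by (simp add: set_of_comp_def psums_def)

lemma psums_Nil [simp]: "psums [] = {}"
  by (auto simp: psums_def)

lemma psums_Cons: "psums (a # as) = (if as = [] then {} else insert a ((+) a ` psums as))"
proof (cases "as = []")
  case False
  have psums_image: "psums bs = (\<lambda>i. sum_list (take i bs)) ` {1..<length bs}" for bs
    by (auto simp: psums_def)
  have "insert 0 {1..<length as} = {0..<length as}" using False by auto
  then have "{1..<length (a # as)} = Suc ` insert 0 {1..<length as}" by simp
  then have "psums (a # as) = (\<lambda>i. a + sum_list (take i as)) ` insert 0 {1..<length as}"
    unfolding psums_image by (simp only: image_image take_Suc_Cons sum_list.Cons)
  then show ?thesis using False by (simp add: psums_image image_image)
qed (auto simp: psums_def)

lemma gam_Cc: "gam (Cc as) = Zc as"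
  by (induction as) (simp_all add: Cc_def Zc_def gam_tbs gam_one_t)

lemma nodes_one_t [simp]: "nodes (one_t n) = n"
  by (induction n) auto

lemma nodes_Cc: "nodes (Cc as) = sum_list as"
  by (induction as) (simp_all add: Cc_def)

lemma tinv_one_t: "\<not> tinv (one_t n) i j"
  by (induction n) (auto simp: tinv_Node)

text \<open>The left combs \<open>one_t a\<close> have no inversions, so the inversions are the
  pairs in different blocks, separated by some partial sum \<open>s\<close>.\<close>

lemma tinv_Cc: "tinv (Cc as) i j \<longleftrightarrow> i < j \<and> j < sum_list as \<and> (\<exists>s\<in>psums as. i < s \<and> s \<le> j)"
proof (induction as arbitrary: i j)
  case (Cons a as)
  have "tinv (Cc (a # as)) i j \<longleftrightarrow> i < j \<and> j < a + sum_list as \<and> a \<le> j \<and> (i < a \<or> tinv (Cc as) (i - a) (j - a))"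
    using nodes_Cc[of as] by (auto simp: Cc_def tinv_tbs tinv_one_t)
  also have "\<dots> \<longleftrightarrow> i < j \<and> j < sum_list (a # as) \<and> (\<exists>s\<in>psums (a # as). i < s \<and> s \<le> j)"
  proof (cases "as = []")
    case False
    have "(\<exists>s\<in>psums as. i - a < s \<and> s \<le> j - a) \<longleftrightarrow> (\<exists>s\<in>psums as. i < a + s \<and> a + s \<le> j)"
      if "a \<le> i" "i < j" using that by (intro bex_cong) auto
    then show ?thesis using False unfolding Cons.IH psums_Cons by (cases "a \<le> i") auto
  qed (auto simp: psums_Cons)
  finally show ?case .
qed (simp add: Cc_def)

lemma psums_bounds: "0 \<notin> set as \<Longrightarrow> psums as \<subseteq> {1..<sum_list as}"
proof (induction as)
  case (Cons a as)
  have "as \<noteq> [] \<Longrightarrow> 0 < sum_list as" using Cons.prems by (cases as) auto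
  then show ?case using Cons by (auto simp: psums_Cons)
qed simp

text \<open>The first of several positive parts is the least proper partial sum; removing it and
  subtracting it from the others leaves the partial sums of the tail.\<close>

lemma set_of_comp_inj:
  "0 \<notin> set as \<Longrightarrow> 0 \<notin> set bs \<Longrightarrow> sum_list as = sum_list bs \<Longrightarrow> psums as = psums bs \<Longrightarrow> as = bs"
proof (induction as arbitrary: bs)
  case Nil
  then show ?case by (cases bs) auto
next
  case (Cons a as)
  then obtain b bs' where bs: "bs = b # bs'" by (cases bs) auto
  show ?case
  proof (cases "as = []")
    case True
    then have "bs' = []" using Cons.prems(4) by (auto simp: bs psums_Cons split: if_splits)
    then show ?thesis using Cons.prems(3) True bs by simp
  next
    case False
    then have ne: "bs' \<noteq> []" using Cons.prems(4) by (auto simp: bs psums_Cons split: if_splits)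
    have eq: "insert a ((+) a ` psums as) = insert b ((+) b ` psums bs')"
      using Cons.prems(4) False ne by (simp add: bs psums_Cons)
    have pos: "\<forall>s\<in>psums as. 0 < s" "\<forall>s\<in>psums bs'. 0 < s"
      using psums_bounds[of as] psums_bounds[of bs'] Cons.prems by (auto simp: bs)
    have "a \<in> insert b ((+) b ` psums bs')" "b \<in> insert a ((+) a ` psums as)" using eq by auto
    then have ab: "a = b" by auto
    have "a \<notin> (+) a ` psums as" "a \<notin> (+) a ` psums bs'" using pos by auto
    then have "(+) a ` psums as = (+) a ` psums bs'" using eq ab by (metis insert_ident)
    then have "psums as = psums bs'" by (simp add: inj_image_eq_iff)
    then show ?thesis using Cons.IH[of bs'] Cons.prems ab bs by auto
  qed
qed

text \<open>Generalizes the base 0 of \<open>comp_of\<close> to \<open>b\<close>, since the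
  induction moves the base on to the head of \<open>ps\<close>.\<close>

lemma diffs_psums:
  assumes "sorted_wrt (<) ps" "\<forall>p\<in>set ps. b < p \<and> p < n" "b < n"
  shows "0 \<notin> set (map (\<lambda>(a, b). a - b) (zip (ps @ [n]) (b # ps)))
    \<and> sum_list (map (\<lambda>(a, b). a - b) (zip (ps @ [n]) (b # ps))) = n - b
    \<and> psums (map (\<lambda>(a, b). a - b) (zip (ps @ [n]) (b # ps))) = (\<lambda>p. p - b) ` set ps"
  using assms
proof (induction ps arbitrary: b)
  case (Cons p ps)
  let ?cs = "map (\<lambda>(a, b). a - b) (zip (ps @ [n]) (p # ps))"
  have IH: "0 \<notin> set ?cs" "sum_list ?cs = n - p" "psums ?cs = (\<lambda>q. q - p) ` set ps"
    using Cons.IH[of p] Cons.prems by auto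
  have ne: "?cs \<noteq> []" by (cases ps) auto
  have "p - b + (q - p) = q - b" if "q \<in> set ps" for q using Cons.prems that by auto
  then have "(+) (p - b) ` psums ?cs = (\<lambda>q. q - b) ` set ps" unfolding IH by (auto simp: image_iff)
  then have "psums ((p - b) # ?cs) = (\<lambda>q. q - b) ` set (p # ps)" using ne by (simp add: psums_Cons)
  then show ?case using IH Cons.prems by auto
qed (simp add: psums_Cons)

lemma comp_of_props:
  assumes "S \<subseteq> {1..<n}"
  shows "0 \<notin> set (comp_of n S)" "set_of_comp (comp_of n S) = (n, S)"
proof -
  have "0 \<notin> set (comp_of n S) \<and> set_of_comp (comp_of n S) = (n, S)"
  proof (cases "n = 0")
    case False
    have fin: "finite S" using assms finite_subset by blast
    have "sorted_wrt (<) (sorted_list_of_set S)" by (rule strict_sorted_list_of_set)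
    moreover have "\<forall>p\<in>set (sorted_list_of_set S). 0 < p \<and> p < n" using assms fin by auto
    moreover have "0 < n" using False by simp
    ultimately show ?thesis
      using diffs_psums[of "sorted_list_of_set S" 0 n] fin False
      unfolding comp_of_def Let_def set_of_comp_eq by simp
  qed (use assms in \<open>auto simp: comp_of_def set_of_comp_eq\<close>)
  then show "0 \<notin> set (comp_of n S)" "set_of_comp (comp_of n S) = (n, S)" by auto
qed

lemma comp_of_set_of_comp:
  assumes "0 \<notin> set as"
  shows "comp_of (sum_list as) (psums as) = as"
  using comp_of_props[OF psums_bounds[OF assms]] assms
  by (intro set_of_comp_inj) (auto simp: set_of_comp_eq)

section \<open>The tree C(S) and the permutation Z(S)\<close>

lemma Ct_eq: "Ct n S = Cc (comp_of n S)"
  by (simp add: Ct_def Cc_def)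

lemma Zp_eq: "Zp n S = gam (Ct n S)"
  by (simp add: Ct_eq gam_Cc Zp_def Zc_def)

lemma nodes_Ct: "S \<subseteq> {1..<n} \<Longrightarrow> nodes (Ct n S) = n"
  using comp_of_props[of S n] by (simp add: Ct_eq nodes_Cc set_of_comp_eq)

lemma tinv_Ct:
  "S \<subseteq> {1..<n} \<Longrightarrow> tinv (Ct n S) i j \<longleftrightarrow> i < j \<and> j < n \<and> (\<exists>s\<in>S. i < s \<and> s \<le> j)"
  using comp_of_props[of S n] by (simp add: Ct_eq tinv_Cc set_of_comp_eq)

text \<open>Both sides say that every inversion \<open>(i, j)\<close> of \<sigma> has some
  \<open>s\<close> in \<open>S\<close> with \<open>i < s\<close> and \<open>s \<le> j\<close>. This
  is the Galois connection between \<open>Des\<close> and \<open>Zp\<close>.\<close>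

lemma wle_Zp_iff:
  assumes "S \<subseteq> {1..<n}" "length \<sigma> = n"
  shows "wle \<sigma> (Zp n S) \<longleftrightarrow> Des \<sigma> \<subseteq> S"
proof -
  have "(i, j) \<in> invs \<sigma> \<Longrightarrow> i < j \<and> j < n" for i j using assms(2) by (simp add: invs_iff)
  moreover have "wle \<sigma> (Zp n S) \<longleftrightarrow> (\<forall>i j. (i, j) \<in> invs \<sigma> \<longrightarrow> tinv (Ct n S) i j)"
    by (auto simp: wle_def Zp_eq tinv_def)
  ultimately show ?thesis unfolding Des_subset_iff tinv_Ct[OF assms(1)] by simp
qed

text \<open>The number of nodes gives \<open>n\<close>, and an \<open>s\<close> with
  \<open>1 \<le> s\<close> and \<open>s < n\<close> belongs to \<open>S\<close> iff
  \<open>(s - 1, s)\<close> is an inversion of the tree.\<close>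

lemma Ct_inj:
  assumes "S \<subseteq> {1..<n}" "T \<subseteq> {1..<m}" "Ct n S = Ct m T"
  shows "n = m \<and> S = T"
proof -
  have nm: "n = m" using assms nodes_Ct by metis
  have "s \<in> S \<longleftrightarrow> s \<in> T" if "1 \<le> s" "s < n" for s
  proof -
    have *: "tinv (Ct n U) (s - 1) s \<longleftrightarrow> s \<in> U" if "U \<subseteq> {1..<n}" for U
    proof -
      have "s - 1 < u \<and> u \<le> s \<longleftrightarrow> u = s" for u using \<open>1 \<le> s\<close> by auto
      then show ?thesis using tinv_Ct[OF that, of "s - 1" s] \<open>1 \<le> s\<close> \<open>s < n\<close> by auto
    qed
    show ?thesis using *[of S] *[of T] assms nm by simp
  qed
  then show ?thesis using nm assms by (auto simp: subset_iff)
qed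

text \<open>A factorization under \<open>tbs\<close> cuts the rightmost branch. For positive parts
  this branch of \<open>Cc as\<close> has one node per part, hence the cuts are those of the
  list.\<close>

lemma tbs_eq_Cc:
  "0 \<notin> set as \<Longrightarrow> {(a, b). tbs a b = Cc as} = (\<lambda>i. (Cc (take i as), Cc (drop i as))) ` {0..length as}"
proof (induction as)
  case Nil
  have "tbs a b = Leaf \<longleftrightarrow> a = Leaf \<and> b = Leaf" for a b by (cases a) auto
  then show ?case by (auto simp: Cc_def)
next
  case (Cons c as)
  then obtain c' where c: "c = Suc c'" by (cases c) auto
  have Cc_c: "Cc (c # bs) = Node (one_t c') (Cc bs)" for bs by (simp add: Cc_def c)
  have "tbs a b = Node l x \<longleftrightarrow> a = Leaf \<and> b = Node l x \<or> (\<exists>a'. a = Node l a' \<and> tbs a' b = x)" for a b l x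
    by (cases a) auto
  then have "{(a, b). tbs a b = Cc (c # as)} =
      insert (Leaf, Cc (c # as)) ((\<lambda>(a, b). (Node (one_t c') a, b)) ` {(a, b). tbs a b = Cc as})"
    unfolding Cc_c by auto
  also have "\<dots> = insert (Leaf, Cc (c # as))
      ((\<lambda>i. (Cc (take (Suc i) (c # as)), Cc (drop (Suc i) (c # as)))) ` {0..length as})"
    using Cons by (simp add: image_image Cc_c)
  also have "\<dots> = (\<lambda>i. (Cc (take i (c # as)), Cc (drop i (c # as)))) ` {0..length (c # as)}"
  proof -
    have "{0..length (c # as)} = insert 0 (Suc ` {0..length as})"
      by (simp only: atLeast0AtMost atMost_Suc_eq_insert_0 list.size add_Suc_right add_0_right)
    then show ?thesis by (simp only: image_insert image_image take_0 drop_0) (simp add: Cc_def[of "[]"])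
  qed
  finally show ?case .
qed

lemma finite_trees: "finite {t. nodes t = n}"
proof -
  have "finite {t. nodes t \<le> n}"
  proof (induction n)
    case 0
    have "t = Leaf" if "nodes t = 0" for t using that by (cases t) auto
    then have "{t. nodes t \<le> 0} \<subseteq> {Leaf}" by auto
    then show ?case by (rule finite_subset) simp
  next
    case (Suc n)
    have "{t. nodes t \<le> Suc n} \<subseteq> insert Leaf (case_prod Node ` ({t. nodes t \<le> n} \<times> {t. nodes t \<le> n}))"
    proof
      fix t assume "t \<in> {t. nodes t \<le> Suc n}"
      then show "t \<in> insert Leaf (case_prod Node ` ({t. nodes t \<le> n} \<times> {t. nodes t \<le> n}))"
        by (cases t) auto
    qed
    then show ?case by (rule finite_subset) (use Suc in auto)
  qed
  then show ?thesis by (rule finite_subset[rotated]) auto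
qed

section \<open>The three coalgebras\<close>

interpretation perm: graded_poset allperms length wle
proof (rule graded_poset.intro)
  fix n
  show "fin_poset {\<sigma> \<in> allperms. length \<sigma> = n} wle"
    by unfold_locales (auto simp: finite_perms wle_def intro: perm_eqI_invs)
qed

interpretation tree: graded_poset UNIV nodes tamari
proof (rule graded_poset.intro)
  fix n
  show "fin_poset {t \<in> UNIV. nodes t = n} tamari"
  proof
    fix s t assume st: "tamari s t" "tamari t s"
    \<comment> \<open>Antisymmetry is inherited from the weak order through the injection
      \<open>gam\<close>.\<close>
    then have "gam s = gam t" by (intro perm_eqI_invs) (auto simp: tamari_iff wle_def)
    then show "s = t" using gam_inj by (simp add: inj_eq)
  qed (auto simp: finite_trees tamari_refl intro: tamari_trans)
qed

lemma SM_eq: "SM = perm.Mb"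
  by (simp add: fun_eq_iff SM_def perm.Mb_def perms_eq)

lemma YM_eq: "YM = tree.Mb"
  by (simp add: fun_eq_iff YM_def tree.Mb_def trees_def)

text \<open>This and the next definitions give the coproducts of single basis elements, whose linear
  extensions are \<open>SCop\<close>, \<open>YCop\<close> and \<open>QCop\<close>, each with the set
  of decompositions prescribed for the M-basis.\<close>

definition pcop :: "nat list \<Rightarrow> nat list \<times> nat list \<Rightarrow> rat" where
  "pcop \<sigma> = (\<lambda>(x, y). \<Sum>p\<in>{0..length \<sigma>}. if (st (take p \<sigma>), st (drop p \<sigma>)) = (x, y) then 1 else 0)"

definition pdec :: "nat list \<Rightarrow> (nat list \<times> nat list) set" where
  "pdec \<sigma> = {(a, b). a \<in> allperms \<and> b \<in> allperms \<and> pbs a b = \<sigma>}"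

definition tcop :: "tree \<Rightarrow> tree \<times> tree \<Rightarrow> rat" where
  "tcop t p = (\<Sum>q\<leftarrow>splits t. if q = p then 1 else 0)"

definition tdec :: "tree \<Rightarrow> (tree \<times> tree) set" where
  "tdec t = {(a, b). tbs a b = t}"

definition qcop :: "nat \<times> nat set \<Rightarrow> (nat \<times> nat set) \<times> (nat \<times> nat set) \<Rightarrow> rat" where
  "qcop = (\<lambda>(n, S) p. let as = comp_of n S in
      \<Sum>i\<in>{0..length as}. if (set_of_comp (take i as), set_of_comp (drop i as)) = p then 1 else 0)"

definition qdec :: "nat \<times> nat set \<Rightarrow> ((nat \<times> nat set) \<times> (nat \<times> nat set)) set" where
  "qdec = (\<lambda>(n, S). let as = comp_of n S in
      (\<lambda>i. (set_of_comp (take i as), set_of_comp (drop i as))) ` {0..length as})"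

interpretation permC: zeta_coalgebra allperms perm.zeta perm.Mb pcop pdec
proof -
  let ?sp = "\<lambda>\<sigma>. map (\<lambda>p. (st (take p \<sigma>), st (drop p \<sigma>))) [0..<Suc (length \<sigma>)]"
  have nth: "?sp \<sigma> ! p = (st (take p \<sigma>), st (drop p \<sigma>))" if "p \<le> length \<sigma>" for \<sigma> p
    using that by (subst nth_map) (auto simp del: upt_Suc)
  have "zeta_coalgebra allperms perm.zeta perm.Mb (\<lambda>\<sigma> p. \<Sum>q\<leftarrow>?sp \<sigma>. if q = p then 1 else 0)
     (\<lambda>x. {(a, b). a \<in> allperms \<and> b \<in> allperms \<and> pbs a b = x})"
  proof (rule perm.zeta_coalgebraI)
    fix \<sigma> p assume "\<sigma> \<in> allperms" and p: "p \<le> length \<sigma>"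
    then have "distinct \<sigma>" by (rule_tac allperms_distinct)
    then show "?sp \<sigma> ! p \<in> allperms \<times> allperms"
      unfolding nth[OF p] by (simp add: st_in_allperms)
    show "length (fst (?sp \<sigma> ! p)) = p \<and> length (snd (?sp \<sigma> ! p)) = length \<sigma> - p"
      unfolding nth[OF p] using p by simp
  next
    fix \<sigma> a b :: "nat list" assume "a \<in> allperms" "b \<in> allperms" and len: "length \<sigma> = length a + length b"
    have "length a \<le> length \<sigma>" using len by simp
    then show "wle \<sigma> (pbs a b) \<longleftrightarrow> wle (fst (?sp \<sigma> ! length a)) a \<and> wle (snd (?sp \<sigma> ! length a)) b"
      by (subst (1 2) nth) (simp_all add: wle_pbs_iff \<open>a \<in> allperms\<close> \<open>b \<in> allperms\<close> len)
  qed (simp_all add: pbs_in_allperms)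
  moreover have "(\<lambda>\<sigma> p. \<Sum>q\<leftarrow>?sp \<sigma>. if q = p then 1 else 0) = pcop"
    by (simp add: fun_eq_iff pcop_def comp_def interv_sum_list_conv_sum_set_nat
        atLeastLessThanSuc_atLeastAtMost del: upt_Suc)
  moreover have "(\<lambda>x. {(a, b). a \<in> allperms \<and> b \<in> allperms \<and> pbs a b = x}) = pdec"
    by (simp add: fun_eq_iff pdec_def)
  ultimately show "zeta_coalgebra allperms perm.zeta perm.Mb pcop pdec" by simp
qed

interpretation treeC: zeta_coalgebra UNIV tree.zeta tree.Mb tcop tdec
proof -
  have "zeta_coalgebra UNIV tree.zeta tree.Mb (\<lambda>t p. \<Sum>q\<leftarrow>splits t. if q = p then 1 else 0)
     (\<lambda>x. {(a, b). a \<in> UNIV \<and> b \<in> UNIV \<and> tbs a b = x})"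
  proof (rule tree.zeta_coalgebraI)
    fix t p assume "p \<le> nodes t"
    then show "nodes (fst (splits t ! p)) = p \<and> nodes (snd (splits t ! p)) = nodes t - p"
      using splits_tinv[of p t "fst (splits t ! p)" "snd (splits t ! p)"] by simp
  qed (simp_all add: length_splits tamari_tbs_iff)
  moreover have "(\<lambda>t p. \<Sum>q\<leftarrow>splits t. if q = p then 1 else 0) = tcop"
    by (simp add: fun_eq_iff tcop_def)
  moreover have "(\<lambda>x. {(a, b). a \<in> UNIV \<and> b \<in> UNIV \<and> tbs a b = x}) = tdec"
    by (simp add: fun_eq_iff tdec_def)
  ultimately show "zeta_coalgebra UNIV tree.zeta tree.Mb tcop tdec" by simp
qed

text \<open>Vectors of QSym are already given in monomial coordinates, hence \<open>z\<close> and \<open>M\<close> are both trivial.\<close>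
interpretation qsym: zeta_coalgebra qbasis delta delta qcop qdec
proof
  fix x :: "nat \<times> nat set" assume x: "x \<in> qbasis"
  obtain n S where nS: "x = (n, S)" by fastforce
  have S: "S \<subseteq> {1..<n}" using x nS by (simp add: qbasis_def)
  define as where "as = comp_of n S"
  have pos: "0 \<notin> set as" unfolding as_def by (rule comp_of_props[OF S])
  let ?f = "\<lambda>i. (set_of_comp (take i as), set_of_comp (drop i as))"
  \<comment> \<open>Positive parts make the partial sums strictly increasing, so different cuts give
    different pairs and \<open>qcop x\<close> has only coefficients 0 and 1.\<close>
  have mono: "sum_list (take i as) < sum_list (take j as)" if "i < j" "j \<le> length as" for i j
  proof -
    have "take j as = take i as @ as ! i # take (j - Suc i) (drop (Suc i) as)"
      using that by (metis Cons_nth_drop_Suc Suc_diff_Suc add_diff_inverse_nat order_less_le_trans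
          not_less_iff_gr_or_eq take_Suc_Cons take_add)
    moreover have "0 < as ! i" using pos that nth_mem[of i as] by (cases "as ! i") auto
    ultimately show ?thesis by simp
  qed
  have inj: "inj_on ?f {0..length as}"
  proof (rule inj_onI)
    fix i j assume "i \<in> {0..length as}" "j \<in> {0..length as}" "?f i = ?f j"
    then show "i = j" using mono[of i j] mono[of j i]
      by (cases i j rule: linorder_cases) (auto simp: set_of_comp_eq)
  qed
  have dec: "qdec x = ?f ` {0..length as}" by (simp add: nS qdec_def as_def Let_def)
  have cop: "qcop x = ind (qdec x)"
  proof
    fix p
    have "qcop x p = (\<Sum>i\<in>{0..length as}. if ?f i = p then 1 else 0)"
      by (simp add: nS qcop_def as_def Let_def)
    also have "\<dots> = (\<Sum>q\<in>qdec x. if q = p then 1 else 0)"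
      unfolding dec by (simp add: sum.reindex[OF inj])
    also have "\<dots> = ind (qdec x) p" by (simp add: ind_def dec)
    finally show "qcop x p = ind (qdec x) p" .
  qed
  show "finite (qdec x)" by (simp add: dec)
  show sub: "qdec x \<subseteq> qbasis \<times> qbasis"
  proof -
    have "set_of_comp bs \<in> qbasis" if "set bs \<subseteq> set as" for bs
      using psums_bounds[of bs] that pos by (auto simp: set_of_comp_eq qbasis_def)
    then show ?thesis unfolding dec by (auto simp: set_take_subset set_drop_subset)
  qed
  show "finite (supp (qcop x))" "supp (qcop x) \<subseteq> qbasis \<times> qbasis"
    using sub by (simp_all add: cop dec)
  have "lsum (qcop x) (\<lambda>(a, b). tensor (delta a) (delta b)) = lsum (qcop x) delta"
    by (rule lsum_cong) (auto simp: tensor_delta)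
  then show "lsum (qcop x) (\<lambda>(a, b). tensor (delta a) (delta b)) = lsum (delta x) (\<lambda>y. ind (qdec y))"
    by (simp add: lsum_delta_right cop dec)
qed simp_all

text \<open>Cuts of a composition correspond to factorizations of its tree by
  \<open>tbs_eq_Cc\<close>; the pieces have positive parts, so \<open>Ct\<close> agrees with
  \<open>Cc\<close> on them.\<close>

lemma qdec_Ct:
  assumes "x \<in> qbasis"
  shows "tdec (case x of (n, S) \<Rightarrow> Ct n S) =
    map_prod (\<lambda>(n, S). Ct n S) (\<lambda>(n, S). Ct n S) ` qdec x"
proof -
  obtain n S where nS: "x = (n, S)" by fastforce
  have S: "S \<subseteq> {1..<n}" using assms nS by (simp add: qbasis_def)
  define as where "as = comp_of n S"
  have pos: "0 \<notin> set as" unfolding as_def by (rule comp_of_props[OF S])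
  have Ct: "(case set_of_comp bs of (n, S) \<Rightarrow> Ct n S) = Cc bs" if "set bs \<subseteq> set as" for bs
  proof -
    have "0 \<notin> set bs" using that pos by blast
    then show ?thesis by (simp add: set_of_comp_eq Ct_eq comp_of_set_of_comp)
  qed
  have "map_prod (\<lambda>(n, S). Ct n S) (\<lambda>(n, S). Ct n S) ` qdec x
    = (\<lambda>i. (Cc (take i as), Cc (drop i as))) ` {0..length as}"
    by (simp add: nS qdec_def as_def[symmetric] image_image Ct set_take_subset set_drop_subset)
  then show ?thesis
    using tbs_eq_Cc[OF pos] by (simp add: nS tdec_def Ct_eq as_def)
qed

lemma pdec_gam: "pdec (gam t) = map_prod gam gam ` tdec t"
  unfolding pdec_def tdec_def by (rule pbs_eq_gam)

interpretation Ct_emb: zeta_coalgebra_embedding qbasis delta delta qcop qdec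
  UNIV tree.zeta tree.Mb tcop tdec "\<lambda>(n, S). Ct n S"
proof
  show "inj_on (\<lambda>(n, S). Ct n S) qbasis"
  proof (rule inj_onI)
    fix x y assume "x \<in> qbasis" "y \<in> qbasis" "(case x of (n, S) \<Rightarrow> Ct n S) = (case y of (n, S) \<Rightarrow> Ct n S)"
    then show "x = y" using Ct_inj[of "snd x" "fst x" "snd y" "fst y"]
      by (simp add: qbasis_def case_prod_unfold prod_eq_iff)
  qed
qed (simp_all only: UNIV_I qdec_Ct)

interpretation gam_emb: zeta_coalgebra_embedding UNIV tree.zeta tree.Mb tcop tdec
  allperms perm.zeta perm.Mb pcop pdec gam
  by unfold_locales (simp_all add: gam_inj pdec_gam)

text \<open>Since Z is \<gamma> after C, injectivity and the matching of decompositions are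
  inherited from these two.\<close>

interpretation Zp_emb: zeta_coalgebra_embedding qbasis delta delta qcop qdec
  allperms perm.zeta perm.Mb pcop pdec "\<lambda>(n, S). Zp n S"
proof
  have Zp: "(\<lambda>(n, S). Zp n S) = gam \<circ> (\<lambda>(n, S). Ct n S)" by (auto simp: Zp_eq)
  show "inj_on (\<lambda>(n, S). Zp n S) qbasis"
    unfolding Zp using Ct_emb.h_inj by (rule comp_inj_on) (rule inj_on_subset[OF gam_inj subset_UNIV])
  fix x assume x: "x \<in> qbasis"
  show "(case x of (n, S) \<Rightarrow> Zp n S) \<in> allperms" by (simp add: Zp_eq case_prod_unfold)
  have "pdec ((gam \<circ> (\<lambda>(n, S). Ct n S)) x) = map_prod (gam \<circ> (\<lambda>(n, S). Ct n S)) (gam \<circ> (\<lambda>(n, S). Ct n S)) ` qdec x"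
    by (simp add: pdec_gam qdec_Ct[OF x] image_image map_prod.comp[symmetric])
  then show "pdec (case x of (n, S) \<Rightarrow> Zp n S) = map_prod (\<lambda>(n, S). Zp n S) (\<lambda>(n, S). Zp n S) ` qdec x"
    unfolding Zp[symmetric] by simp
qed

section \<open>The maps between them\<close>

lemma QVec_eq: "QVec = qsym.V" by (simp add: QVec_def qsym.V_def)
lemma YVec_eq: "YVec = tree.V" by (simp add: YVec_def tree.V_def)

lemma QCop_eq: "QCop = (\<lambda>v. lsum v qcop)" by (simp add: fun_eq_iff QCop_def qcop_def)
lemma YCop_eq: "YCop = (\<lambda>v. lsum v tcop)" by (simp add: fun_eq_iff YCop_def tcop_def[abs_def])
lemma SCop_eq: "SCop = (\<lambda>v. lsum v pcop)" by (simp add: fun_eq_iff SCop_def pcop_def[abs_def])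

lemma CMap_eq: "CMap v = lsum v (\<lambda>x. tree.Mb (case x of (n, S) \<Rightarrow> Ct n S))"
  by (simp add: CMap_def YM_eq case_prod_unfold)

lemma ZMap_eq: "ZMap v = lsum v (\<lambda>x. perm.Mb (case x of (n, S) \<Rightarrow> Zp n S))"
  by (simp add: ZMap_def SM_eq case_prod_unfold)

text \<open>Any finitely supported coordinates are recovered from the vector by
  \<open>tree.zeta\<close>, which gives the uniqueness that the definite description asks
  for.\<close>

lemma coords_YM:
  assumes "c \<in> tree.V"
  shows "coords YM (lsum c YM) = c"
  unfolding coords_def
proof (rule the_equality)
  show "finite (supp c) \<and> lsum c YM = lsum c YM" using assms by (simp add: tree.finite_V)
  fix c' assume c': "finite (supp c') \<and> lsum c YM = lsum c' YM"
  then have "c' \<in> tree.V" by (simp add: tree.V_def)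
  then have "c' = lsum (lsum c' YM) tree.zeta" by (simp add: YM_eq tree.lsum_M_z)
  also have "lsum c' YM = lsum c YM" using c' by simp
  also have "lsum (lsum c YM) tree.zeta = c" using assms by (simp add: YM_eq tree.lsum_M_z)
  finally show "c' = c" .
qed

lemma GamMap_eq:
  assumes "v \<in> tree.V"
  shows "GamMap v = lsum (lsum v tree.zeta) (\<lambda>t. perm.Mb (gam t))"
  using coords_YM[OF tree.lsum_z_in_V[OF assms]] tree.lsum_z_M[OF assms]
  by (simp add: GamMap_def SM_eq YM_eq)

lemma GamMap_CMap:
  assumes v: "v \<in> qsym.V"
  shows "GamMap (CMap v) = ZMap v"
proof -
  \<comment> \<open>These are the M-coordinates of \<open>CMap v\<close>.\<close>
  let ?c = "lsum v (\<lambda>x. delta (case x of (n, S) \<Rightarrow> Ct n S))"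
  have fin: "finite (supp v)" by (rule qsym.finite_V[OF v])
  then have c: "?c \<in> tree.V" by (auto simp: tree.V_def intro: finite_supp_lsum)
  have "lsum ?c YM = CMap v" unfolding CMap_eq by (subst lsum_lsum) (simp_all add: fin YM_eq)
  then have "GamMap (CMap v) = lsum ?c (\<lambda>t. SM (gam t))"
    using coords_YM[OF c] by (simp add: GamMap_def)
  also have "\<dots> = ZMap v"
    unfolding ZMap_eq by (subst lsum_lsum) (simp_all add: fin SM_eq Zp_eq case_prod_unfold)
  finally show ?thesis .
qed

lemma LMap_CMap:
  assumes v: "v \<in> qsym.V"
  shows "LMap (CMap v) = v"
proof -
  have "QF (nodes t, Lset t) =
      lsum (\<lambda>x. if x \<in> qbasis then tree.zeta t (case x of (n, S) \<Rightarrow> Ct n S) else 0) delta" (is "?F = lsum ?w delta") for t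
  proof -
    have F: "?F = ?w"
    proof
      fix x :: "nat \<times> nat set"
      obtain n S where x: "x = (n, S)" by fastforce
      \<comment> \<open>The Galois connection between \<open>Lset\<close> and \<open>Ct\<close>,
        transferred from \<open>Des\<close> and \<open>Zp\<close> through
        \<open>gam\<close>.\<close>
      have "tamari t (Ct n S) \<longleftrightarrow> nodes t = n \<and> Lset t \<subseteq> S" if "S \<subseteq> {1..<n}"
        using that wle_Zp_iff[OF that, of "gam t"] nodes_Ct[OF that] by (auto simp: tamari_iff Zp_eq Des_gam)
      then show "?F x = ?w x"
        using nodes_Ct[of S n] by (auto simp: x QF_def qbasis_def tree.zeta_def)
    qed
    have "supp ?F \<subseteq> {nodes t} \<times> Pow {1..<nodes t}"
      unfolding supp_def QF_def by (clarsimp split: if_splits)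
    then have "finite (supp ?F)" by (rule finite_subset) simp
    then show ?thesis using lsum_delta_right[of ?F] unfolding F by simp
  qed
  then have "lsum (lsum v (\<lambda>x. tree.Mb (case x of (n, S) \<Rightarrow> Ct n S))) (\<lambda>t. QF (nodes t, Lset t)) = lsum v delta"
    by (intro Ct_emb.splitting_lsum v)
  then show ?thesis by (simp add: LMap_def CMap_eq lsum_delta_right qsym.finite_V[OF v])
qed

lemma DMap_ZMap:
  assumes v: "v \<in> qsym.V"
  shows "DMap (ZMap v) = v"
proof -
  have "QF (length \<sigma>, Des \<sigma>) =
      lsum (\<lambda>x. if x \<in> qbasis then perm.zeta \<sigma> (case x of (n, S) \<Rightarrow> Zp n S) else 0) delta" (is "?F = lsum ?w delta")
    if \<sigma>: "\<sigma> \<in> allperms" for \<sigma>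
  proof -
    have F: "?F = ?w"
    proof
      fix x :: "nat \<times> nat set"
      obtain n S where x: "x = (n, S)" by fastforce
      \<comment> \<open>The M-coordinates of \<open>QF (length \<sigma>, Des \<sigma>)\<close>
        single out the supersets of \<open>Des \<sigma>\<close>; by \<open>wle_Zp_iff\<close> these
        are the \<open>S\<close> with \<sigma> below \<open>Zp n S\<close>.\<close>
      show "?F x = ?w x"
        using nodes_Ct[of S n] wle_Zp_iff[of S n \<sigma>] \<sigma>
        by (cases "S \<subseteq> {1..<n}"; cases "length \<sigma> = n")
          (simp_all add: x QF_def qbasis_def perm.zeta_def Zp_eq)
    qed
    have "supp ?F \<subseteq> {length \<sigma>} \<times> Pow {1..<length \<sigma>}"
      unfolding supp_def QF_def by (clarsimp split: if_splits)
    then have "finite (supp ?F)" by (rule finite_subset) simp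
    then show ?thesis using lsum_delta_right[of ?F] unfolding F by simp
  qed
  then have "lsum (lsum v (\<lambda>x. perm.Mb (case x of (n, S) \<Rightarrow> Zp n S))) (\<lambda>\<sigma>. QF (length \<sigma>, Des \<sigma>)) = lsum v delta"
    by (intro Zp_emb.splitting_lsum v)
  then show ?thesis by (simp add: DMap_def ZMap_eq lsum_delta_right qsym.finite_V[OF v])
qed

lemma LamMap_GamMap:
  assumes v: "v \<in> tree.V"
  shows "LamMap (GamMap v) = v"
proof -
  have "delta (lam \<sigma>) = lsum (\<lambda>t. if t \<in> UNIV then perm.zeta \<sigma> (gam t) else 0) tree.Mb"
    if \<sigma>: "\<sigma> \<in> allperms" for \<sigma>
  proof -
    \<comment> \<open>By the Galois connection, \<sigma> lying below \<open>gam t\<close> is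
      recorded by the row \<open>lam \<sigma>\<close> of the zeta function of trees, whose expansion
      in the M-basis is the basis vector of \<open>lam \<sigma>\<close>.\<close>
    have "(\<lambda>t. if t \<in> UNIV then perm.zeta \<sigma> (gam t) else 0) = tree.zeta (lam \<sigma>)"
      using lam_gam_galois[OF \<sigma>] nodes_lam[OF \<sigma>]
      by (auto simp: fun_eq_iff perm.zeta_def tree.zeta_def \<sigma>)
    then show ?thesis by (simp add: tree.z_M)
  qed
  then have "lsum (lsum (lsum v tree.zeta) (\<lambda>t. perm.Mb (gam t))) (\<lambda>\<sigma>. delta (lam \<sigma>)) = lsum (lsum v tree.zeta) tree.Mb"
    by (intro gam_emb.splitting_lsum tree.lsum_z_in_V v)
  then show ?thesis by (simp add: LamMap_def GamMap_eq[OF v] tree.lsum_z_M[OF v])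
qed

lemma nodes_eq_0: "nodes t = 0 \<longleftrightarrow> t = Leaf"
  by (cases t) auto

lemma coalg_hom_CMap: "coalg_hom QVec QCop QEps YCop YEps CMap"
  unfolding QVec_eq QCop_eq YCop_eq QEps_def YEps_def
proof (rule Ct_emb.coalg_hom)
  fix v assume "v \<in> qsym.V"
  then show "CMap v = lsum (lsum v delta) (\<lambda>x. tree.Mb (case x of (n, S) \<Rightarrow> Ct n S))"
    by (simp add: CMap_eq lsum_delta_right qsym.finite_V)
next
  fix x assume x: "x \<in> qbasis"
  show "delta x (0, {}) = (if x = (0, {}) then 1 else 0)" by (auto simp: delta_def)
  obtain n S where nS: "x = (n, S)" by fastforce
  show "tree.Mb (case x of (n, S) \<Rightarrow> Ct n S) Leaf = (if x = (0, {}) then 1 else 0)"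
  \<comment> \<open>The empty composition gives \<open>Leaf\<close>; in positive degree a vector of
    the M-basis has coefficient 0 at \<open>Leaf\<close>.\<close>
  proof (cases "n = 0")
    case True
    then show ?thesis using x tree.Mb_self[of Leaf] by (simp add: nS qbasis_def Ct_def comp_of_def)
  next
    case False
    then show ?thesis using x nodes_Ct[of S n] by (simp add: nS qbasis_def tree.Mb_deg)
  qed
qed

lemma coalg_hom_ZMap: "coalg_hom QVec QCop QEps SCop SEps ZMap"
  unfolding QVec_eq QCop_eq SCop_eq QEps_def SEps_def
proof (rule Zp_emb.coalg_hom)
  fix v assume "v \<in> qsym.V"
  then show "ZMap v = lsum (lsum v delta) (\<lambda>x. perm.Mb (case x of (n, S) \<Rightarrow> Zp n S))"
    by (simp add: ZMap_eq lsum_delta_right qsym.finite_V)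
next
  fix x assume x: "x \<in> qbasis"
  show "delta x (0, {}) = (if x = (0, {}) then 1 else 0)" by (auto simp: delta_def)
  obtain n S where nS: "x = (n, S)" by fastforce
  show "perm.Mb (case x of (n, S) \<Rightarrow> Zp n S) [] = (if x = (0, {}) then 1 else 0)"
  proof (cases "n = 0")
    case True
    then show ?thesis using x perm.Mb_self[of "[]"]
      by (simp add: nS qbasis_def Zp_def comp_of_def allperms_iff)
  next
    case False
    then show ?thesis using x nodes_Ct[of S n] by (simp add: nS qbasis_def perm.Mb_deg Zp_eq)
  qed
qed

lemma coalg_hom_GamMap: "coalg_hom YVec YCop YEps SCop SEps GamMap"
  unfolding YVec_eq YCop_eq SCop_eq YEps_def SEps_def
proof (rule gam_emb.coalg_hom)
  fix t
  have "tamari Leaf Leaf" by (rule tamari_refl)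
  then show "tree.zeta t Leaf = (if t = Leaf then 1 else 0)"
    using nodes_eq_0[of t] by (auto simp: tree.zeta_def)
  show "perm.Mb (gam t) [] = (if t = Leaf then 1 else 0)"
    using perm.Mb_self[of "[]"] nodes_eq_0[of t] by (auto simp: perm.Mb_deg allperms_iff)
qed (rule GamMap_eq)

theorem theorem7p1:
  shows "coalg_hom QVec QCop QEps YCop YEps CMap \<and> inj_on CMap QVec
       \<and> coalg_hom YVec YCop YEps SCop SEps GamMap \<and> inj_on GamMap YVec
       \<and> coalg_hom QVec QCop QEps SCop SEps ZMap \<and> inj_on ZMap QVec
       \<and> (\<forall>v\<in>QVec. GamMap (CMap v) = ZMap v)
       \<and> (\<forall>v\<in>QVec. LMap (CMap v) = v)
       \<and> (\<forall>v\<in>YVec. LamMap (GamMap v) = v)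
       \<and> (\<forall>v\<in>QVec. DMap (ZMap v) = v)"
proof (intro conjI ballI)
  show "inj_on CMap QVec" by (rule inj_on_inverseI[of _ LMap]) (simp add: QVec_eq LMap_CMap)
  show "inj_on GamMap YVec" by (rule inj_on_inverseI[of _ LamMap]) (simp add: YVec_eq LamMap_GamMap)
  show "inj_on ZMap QVec" by (rule inj_on_inverseI[of _ DMap]) (simp add: QVec_eq DMap_ZMap)
qed (simp_all add: coalg_hom_CMap coalg_hom_GamMap coalg_hom_ZMap, simp_all add: QVec_eq YVec_eq
    GamMap_CMap LMap_CMap LamMap_GamMap DMap_ZMap)

end
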